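(* Let $\ell\in\mathbb R$ with $\ell>K''(\beta_c)$. For $\alpha>0$ define $$\beta_n=\beta_c-\frac1{n^\alpha},\qquad K_n=K(\beta_c)-\frac{K'(\beta_c)}{n^\alpha}+\frac{\ell}{2n^{2\alpha}} .$$ Let $$g(x)=\tfrac12\beta_c\bigl(K''(\beta_c)-\ell\bigr)x^2+4c_4x^4+c_6x^6,\qquad \tilde g(x)=c_6x^6,\qquad c_4=3/16,\quad c_6=9/40,$$ let $\bar x>0$ be the unique positive global minimum point of $g$, and let $$\bar y=\frac{\int_{\mathbb R}|x|\exp[-\tilde g(x)]\,dx}{\int_{\mathbb R}\exp[-\tilde g(x)]\,dx},\qquad \bar z=\frac{\int_{\mathbb R}|x|\exp[-g(x)]\,dx}{\int_{\mathbb R}\exp[-g(x)]\,dx}.$$ Then: (a) For all $\alpha>0$, $m(\beta_n,K_n)\sim\bar x/n^{\alpha/2}=\bar x(\beta_c-\beta_n)^{1/2}$. (b) For all $0<\alpha<\alpha_0=1/3$, $E_{n,\beta_n,K_n}\{|S_n/n|\}\sim\bar x/n^{\alpha/2}\sim m(\beta_n,K_n)$. (c) For all $\alpha>\alpha_0=1/3$, $E_{n,\beta_n,K_n}\{|S_n/n|\}\sim\bar y/n^{1/6}\gg m(\beta_n,K_n)$. (d) For $\alpha=\alpha_0=1/3$, $E_{n,\beta_n,K_n}\{|S_n/n|\}\sim\bar z/n^{1/6}\sim\bar z\cdot m(\beta_n,K_n)/\bar x$.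
   Context: Mean-field Blume--Capel model. Let $\Lambda=\{1,0,-1\}$. For $n\in\mathbb N$, $K>0$ and $\omega=(\omega_1,\dots,\omega_n)\in\Lambda^n$ put $S_n(\omega)=\sum_{j=1}^n\omega_j$ and $H_{n,K}(\omega)=\sum_{j=1}^n\omega_j^2-\frac Kn\bigl(\sum_{j=1}^n\omega_j\bigr)^2$. For $\beta>0$, $P_{n,\beta,K}$ is the probability measure on $\Lambda^n$ giving $\omega$ probability proportional to $\exp[-\beta H_{n,K}(\omega)]$; $E_{n,\beta,K}$ denotes expectation with respect to $P_{n,\beta,K}$. Free-energy functional: $c_\beta(t)=\log\frac{1+e^{-\beta}(e^t+e^{-t})}{1+2e^{-\beta}}$ and $G_{\beta,K}(x)=\beta Kx^2-c_\beta(2\beta Kx)$ for $x\in\mathbb R$. $\mathcal M_{\beta,K}$ is the set of global minimum points of $G_{\beta,K}$. Let $\beta_c=\log4$ and $K(\beta)=(e^\beta+2)/(4\beta)$ for $\beta>0$; $K',K''$ are derivatives of this function. The phase-coexistence region is the set of $(\beta,K)$, $\beta,K>0$, for which $\mathcal M_{\beta,K}$ has more than one element. It is known that for such $(\beta,K)$, $\mathcal M_{\beta,K}$ is $\{\pm m(\beta,K)\}$ or $\{0,\pm m(\beta,K)\}$ with $m(\beta,K)>0$; this unique positive global minimum point $m(\beta,K)$ is the thermodynamic magnetization. Notation: $a_n\sim b_n$ means $a_n/b_n\to1$ and $a_n\gg b_n$ means $a_n/b_n\to\infty$ as $n\to\infty$. All quantities are considered for $n$ large enough that $\beta_n,K_n>0$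 and $(\beta_n,K_n)$ lies in the phase-coexistence region (which holds for all sufficiently large $n$ under the stated assumptions). *)

theory Defs
  imports "HOL-Probability.Probability"
begin

section \<open>The mean-field Blume--Capel model\<close>

definition spins :: "real set" where
  "spins = {1, 0, -1}"

definition configs :: "nat \<Rightarrow> (nat \<Rightarrow> real) set" where
  "configs n = {1..n} \<rightarrow>\<^sub>E spins"

definition spin_sum :: "nat \<Rightarrow> (nat \<Rightarrow> real) \<Rightarrow> real" where
  "spin_sum n \<omega> = (\<Sum>j=1..n. \<omega> j)"

definition hamiltonian :: "nat \<Rightarrow> real \<Rightarrow> (nat \<Rightarrow> real) \<Rightarrow> real" where
  "hamiltonian n K \<omega> = (\<Sum>j=1..n. (\<omega> j)\<^sup>2) - K / real n * (\<Sum>j=1..n. \<omega> j)\<^sup>2"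

definition partition_fun :: "nat \<Rightarrow> real \<Rightarrow> real \<Rightarrow> real" where
  "partition_fun n \<beta> K = (\<Sum>\<omega>\<in>configs n. exp (- \<beta> * hamiltonian n K \<omega>))"

definition gibbs :: "nat \<Rightarrow> real \<Rightarrow> real \<Rightarrow> (nat \<Rightarrow> real) measure" where
  "gibbs n \<beta> K = point_measure (configs n)
     (\<lambda>\<omega>. ennreal (exp (- \<beta> * hamiltonian n K \<omega>) / partition_fun n \<beta> K))"

definition expect :: "nat \<Rightarrow> real \<Rightarrow> real \<Rightarrow> ((nat \<Rightarrow> real) \<Rightarrow> real) \<Rightarrow> real" where
  "expect n \<beta> K f = (LINT \<omega>|gibbs n \<beta> K. f \<omega>)"

lemma finite_configs: "finite (configs n)"
  unfolding configs_def spins_def by (intro finite_PiE) auto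

lemma configs_nonempty: "configs n \<noteq> {}"
  unfolding configs_def spins_def by (simp add: PiE_eq_empty_iff)

lemma partition_fun_pos: "0 < partition_fun n \<beta> K"
  unfolding partition_fun_def
  by (intro sum_pos finite_configs configs_nonempty) simp

lemma prob_space_gibbs: "prob_space (gibbs n \<beta> K)"
proof (rule prob_spaceI)
  let ?p = "\<lambda>\<omega>. exp (- \<beta> * hamiltonian n K \<omega>) / partition_fun n \<beta> K"
  have "emeasure (gibbs n \<beta> K) (space (gibbs n \<beta> K)) = (\<Sum>\<omega>\<in>configs n. ennreal (?p \<omega>))"
    unfolding gibbs_def
    by (simp add: space_point_measure emeasure_point_measure_finite finite_configs)
  also have "\<dots> = ennreal (\<Sum>\<omega>\<in>configs n. ?p \<omega>)"
    by (rule sum_ennreal) (simp add: partition_fun_pos less_imp_le)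
  also have "(\<Sum>\<omega>\<in>configs n. ?p \<omega>) = 1"
    using partition_fun_pos[of n \<beta> K]
    unfolding sum_divide_distrib[symmetric] partition_fun_def[symmetric] by simp
  finally show "emeasure (gibbs n \<beta> K) (space (gibbs n \<beta> K)) = 1" by simp
qed

section \<open>Free-energy functional and thermodynamic magnetization\<close>

definition global_min_points :: "(real \<Rightarrow> real) \<Rightarrow> real set" where
  "global_min_points f = {x. \<forall>y. f x \<le> f y}"

definition c_fun :: "real \<Rightarrow> real \<Rightarrow> real" where
  "c_fun \<beta> t = ln ((1 + exp (- \<beta>) * (exp t + exp (- t))) / (1 + 2 * exp (- \<beta>)))"

definition free_energy :: "real \<Rightarrow> real \<Rightarrow> real \<Rightarrow> real" where
  "free_energy \<beta> K x = \<beta> * K * x\<^sup>2 - c_fun \<beta> (2 * \<beta> * K * x)"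

definition minimizers :: "real \<Rightarrow> real \<Rightarrow> real set" where
  "minimizers \<beta> K = global_min_points (free_energy \<beta> K)"

definition phase_coexistence :: "(real \<times> real) set" where
  "phase_coexistence =
     {(\<beta>, K). 0 < \<beta> \<and> 0 < K \<and> (\<exists>x\<in>minimizers \<beta> K. \<exists>y\<in>minimizers \<beta> K. x \<noteq> y)}"

text \<open>Meaningful only on \<^term>\<open>phase_coexistence\<close>, where the positive global
  minimum point exists and is unique.\<close>

definition magnetization :: "real \<Rightarrow> real \<Rightarrow> real" where
  "magnetization \<beta> K = (THE x. 0 < x \<and> x \<in> minimizers \<beta> K)"

section \<open>The sequences and the limiting polynomials\<close>

definition \<beta>c :: real where
  "\<beta>c = ln 4"

definition Kcrit :: "real \<Rightarrow> real" where
  "Kcrit \<beta> = (exp \<beta> + 2) / (4 * \<beta>)"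

definition \<beta>seq :: "real \<Rightarrow> nat \<Rightarrow> real" where
  "\<beta>seq \<alpha> n = \<beta>c - 1 / real n powr \<alpha>"

definition Kseq :: "real \<Rightarrow> real \<Rightarrow> nat \<Rightarrow> real" where
  "Kseq l \<alpha> n = Kcrit \<beta>c - deriv Kcrit \<beta>c / real n powr \<alpha> + l / (2 * real n powr (2 * \<alpha>))"

definition c4 :: real where
  "c4 = 3 / 16"

definition c6 :: real where
  "c6 = 9 / 40"

definition g_lim :: "real \<Rightarrow> real \<Rightarrow> real" where
  "g_lim l x = 1 / 2 * \<beta>c * (deriv (deriv Kcrit) \<beta>c - l) * x ^ 2 + 4 * c4 * x ^ 4 + c6 * x ^ 6"

definition g_tilde :: "real \<Rightarrow> real" where
  "g_tilde x = c6 * x ^ 6"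

definition x_bar :: "real \<Rightarrow> real" where
  "x_bar l = (THE x. 0 < x \<and> x \<in> global_min_points (g_lim l))"

definition y_bar :: real where
  "y_bar = (LINT x|lborel. \<bar>x\<bar> * exp (- g_tilde x)) / (LINT x|lborel. exp (- g_tilde x))"

definition z_bar :: "real \<Rightarrow> real" where
  "z_bar l = (LINT x|lborel. \<bar>x\<bar> * exp (- g_lim l x)) / (LINT x|lborel. exp (- g_lim l x))"

section \<open>Asymptotic comparison of sequences\<close>

definition sim :: "(nat \<Rightarrow> real) \<Rightarrow> (nat \<Rightarrow> real) \<Rightarrow> bool" where
  "sim a b \<longleftrightarrow> (\<lambda>n. a n / b n) \<longlonglongrightarrow> 1"

definition dominates :: "(nat \<Rightarrow> real) \<Rightarrow> (nat \<Rightarrow> real) \<Rightarrow> bool" where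
  "dominates a b \<longleftrightarrow> filterlim (\<lambda>n. a n / b n) at_top sequentially"

end

theory Submission imports Defs "HOL-Real_Asymp.Real_Asymp" begin

text \<open>
  Write \<open>a = exp \<beta> / 2\<close>, \<open>k = 2 \<beta> K\<close> and \<open>t = k x\<close>. The free energy becomes
  \<open>t\<^sup>2 / (2 k) - ln ((a + cosh t) / (a + 1))\<close>, and the numerator of its derivative is
  \<open>- (k - a - 1) t + (3 - k) (sinh t - t) + (t cosh t - 3 sinh t + 2 t)\<close>. The sequence
  approaches the tricritical point \<open>a = 2\<close>, \<open>k = 3\<close> with \<open>k - a - 1\<close> of the order \<open>n powr (- 2 \<alpha>)\<close> and
  \<open>3 - k\<close> of the order \<open>n powr (- \<alpha>)\<close>, both positive (\<open>parameter_expansion\<close>). Consequently: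

  \<^item> The free energy is an even double well with one positive minimum point, because the
    derivative divided by \<open>t\<close> changes sign once (\<open>double_well_well\<close>).
  \<^item> At distances of the order \<open>\<delta>\<close> from 0 the three terms have sizes \<open>n powr (- 2 \<alpha>) \<delta>\<^sup>2\<close>,
    \<open>n powr (- \<alpha>) \<delta>\<^sup>4\<close> and \<open>\<delta>\<^sup>6\<close>. For \<open>\<delta> = n powr (- \<alpha> / 2)\<close> they are of equal order, and the free
    energy divided by \<open>\<delta>\<^sup>6\<close> tends to the polynomial \<^const>\<open>g_lim\<close>; for larger \<open>\<delta>\<close> the sixth
    power alone survives (\<open>scaled_free_energy\<close>).

  Minimum points of double wells converge along with the functions, which gives the asymptotics of
  the magnetization.

  For the spin sum \<open>S\<close>, the Hubbard--Stratonovich identity (\<open>hubbard_stratonovich\<close>) says that \<open>S / n\<close>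
  plus an independent Gaussian of size \<open>n powr (- 1 / 2)\<close> has a density proportional to
  \<open>exp (- n G)\<close>, with \<open>G\<close> the free energy. On the scale \<open>\<delta>\<close> the exponent \<open>n G\<close> is of order \<open>n \<delta>\<^sup>6\<close>. If
  \<open>\<alpha> < 1 / 3\<close>, this diverges for \<open>\<delta> = n powr (- \<alpha> / 2)\<close> and the law concentrates at the two minimum
  points (\<open>tendsto_gibbs_abs_mean_double_well\<close>), so that the mean absolute value follows the
  magnetization. If \<open>\<alpha> \<ge> 1 / 3\<close>, fluctuations live on the scale \<open>\<delta> = n powr (- 1 / 6)\<close>, where the
  exponent converges, to \<^const>\<open>g_lim\<close> if \<open>\<alpha> = 1 / 3\<close> and to \<^const>\<open>g_tilde\<close> if \<open>\<alpha> > 1 / 3\<close>. A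
  coercive bound uniform in \<open>n\<close> (\<open>well_coercive\<close>) allows dominated convergence
  (\<open>tendsto_gibbs_abs_mean\<close>). In all cases the Gaussian is too small to matter.
\<close>

section \<open>Double wells\<close>

text \<open>
  The shape shared by the free energy, its rescalings and the limiting polynomial. It is
  all that the location of minimum points and the Laplace argument use: between two points of
  known value the graph is controlled by monotonicity, so pointwise convergence of a sequence of
  double wells suffices where one would otherwise ask for locally uniform convergence.
\<close>

definition double_well :: "(real \<Rightarrow> real) \<Rightarrow> real \<Rightarrow> bool" where
  "double_well f m \<longleftrightarrow> 0 < m \<and> (\<forall>x. f (- x) = f x) \<and>
     strict_antimono_on {0..m} f \<and> strict_mono_on {m..} f"

text \<open>
  The factorization of the derivative into a positive factor \<^term>\<open>p\<close> and a strictly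
  increasing factor \<^term>\<open>s\<close> leaves exactly one sign change, at the zero of \<^term>\<open>s\<close>.
\<close>

lemma double_wellI:
  fixes f :: "real \<Rightarrow> real"
  assumes even: "\<And>x. f (- x) = f x"
    and deriv: "\<And>x. 0 < x \<Longrightarrow> (f has_real_derivative p x * s x) (at x)"
    and cont: "continuous_on {0..} f"
    and p: "\<And>x. 0 < x \<Longrightarrow> 0 < p x"
    and s: "strict_mono_on {0<..} s"
    and m: "0 < m" "s m = 0"
  shows "double_well f m"
proof -
  have sneg: "s x < 0" if "0 < x" "x < m" for x
    using strict_mono_onD[OF s, of x m] that m by auto
  have spos: "0 < s x" if "m < x" for x
    using strict_mono_onD[OF s, of m x] that m by auto
  have "strict_antimono_on {0..m} f"
  proof (rule monotone_onI)
    fix x y assume *: "x \<in> {0..m}" "y \<in> {0..m}" "x < y"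
    show "f x > f y"
    proof (rule DERIV_neg_imp_decreasing_open[OF \<open>x < y\<close>])
      fix t assume "x < t" "t < y"
      then show "\<exists>y. (f has_real_derivative y) (at t) \<and> y < 0"
        using * deriv[of t] p[of t] sneg[of t] by (auto simp: mult_less_0_iff intro!: exI)
    qed (use * in \<open>auto intro: continuous_on_subset[OF cont]\<close>)
  qed
  moreover have "strict_mono_on {m..} f"
  proof (rule monotone_onI)
    fix x y assume *: "x \<in> {m..}" "y \<in> {m..}" "x < y"
    show "f x < f y"
    proof (rule DERIV_pos_imp_increasing_open[OF \<open>x < y\<close>])
      fix t assume "x < t" "t < y"
      then show "\<exists>y. (f has_real_derivative y) (at t) \<and> y > 0"
        using * m deriv[of t] p[of t] spos[of t] by (auto intro!: exI)
    qed (use * m in \<open>auto intro: continuous_on_subset[OF cont]\<close>)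
  qed
  ultimately show ?thesis using even m by (simp add: double_well_def)
qed

lemma double_well_pos: "double_well f m \<Longrightarrow> 0 < m"
  by (simp add: double_well_def)

lemma double_well_abs: "double_well f m \<Longrightarrow> f \<bar>x\<bar> = f x"
  by (simp add: double_well_def abs_if)

lemma double_well_less:
  assumes "double_well f m"
  shows "0 \<le> x \<Longrightarrow> x < y \<Longrightarrow> y \<le> m \<Longrightarrow> f y < f x"
    and "m \<le> x \<Longrightarrow> x < y \<Longrightarrow> f x < f y"
  using assms monotone_onD[of "{0..m}" "(<)" "(>)" f x y] monotone_onD[of "{m..}" "(<)" "(<)" f x y]
  by (simp_all add: double_well_def)

lemma double_well_le:
  assumes "double_well f m"
  shows "0 \<le> x \<Longrightarrow> x \<le> y \<Longrightarrow> y \<le> m \<Longrightarrow> f y \<le> f x"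
    and "m \<le> x \<Longrightarrow> x \<le> y \<Longrightarrow> f x \<le> f y"
  using double_well_less[OF assms, of x y] by (auto simp: le_less)

lemma global_min_points_double_well:
  assumes "double_well f m"
  shows "global_min_points f = {m, - m}"
proof -
  have less: "f m < f x" if "\<bar>x\<bar> \<noteq> m" for x
    using double_well_less[OF assms, of "\<bar>x\<bar>" m] double_well_less[OF assms, of m "\<bar>x\<bar>"]
      that double_well_abs[OF assms, of x] by (cases "\<bar>x\<bar> < m") auto
  have eq: "f x = f m" if "\<bar>x\<bar> = m" for x
    using that double_well_abs[OF assms, of x] by simp
  have "x \<in> global_min_points f \<longleftrightarrow> \<bar>x\<bar> = m" for x
  proof
    assume "x \<in> global_min_points f"
    then have "f x \<le> f m" by (simp add: global_min_points_def)
    then show "\<bar>x\<bar> = m" using less[of x] by linarith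
  next
    assume "\<bar>x\<bar> = m"
    moreover have "f m \<le> f y" for y using less[of y] eq[of y] by (cases "\<bar>y\<bar> = m") auto
    ultimately show "x \<in> global_min_points f" using eq[of x] by (simp add: global_min_points_def)
  qed
  moreover have "\<bar>x\<bar> = m \<longleftrightarrow> x = m \<or> x = - m" for x
    using double_well_pos[OF assms] by linarith
  ultimately show ?thesis by blast
qed

lemma positive_global_min_double_well:
  assumes "double_well f m"
  shows "0 < x \<and> x \<in> global_min_points f \<longleftrightarrow> x = m"
  using double_well_pos[OF assms] unfolding global_min_points_double_well[OF assms] by auto

lemma double_well_rescale:
  assumes "double_well f m" "0 < c" "0 < b"
  shows "double_well (\<lambda>x. f (c * x) / b) (m / c)"
proof -
  have "f (c * y) < f (c * x)" if "0 \<le> x" "x < y" "y \<le> m / c" for x y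
    using that assms(2) by (intro double_well_less(1)[OF assms(1)]) (auto simp: pos_le_divide_eq mult.commute)
  moreover have "f (c * x) < f (c * y)" if "m / c \<le> x" "x < y" for x y
    using that assms(2) by (intro double_well_less(2)[OF assms(1)]) (auto simp: pos_divide_le_eq mult.commute)
  ultimately show ?thesis
    using assms by (simp add: double_well_def monotone_on_def divide_strict_right_mono)
qed

text \<open>
  If \<^term>\<open>z < a\<close> and the minimum of \<^term>\<open>f n\<close> were at most \<^term>\<open>z\<close>, then \<^term>\<open>f n\<close>
  would increase from \<^term>\<open>z\<close> to \<^term>\<open>a\<close>, while the limit strictly decreases there; similarly
  to the right of \<^term>\<open>a\<close>.
\<close>

lemma tendsto_double_well_min:
  assumes f: "\<And>x. 0 < x \<Longrightarrow> (\<lambda>n. f n x) \<longlonglongrightarrow> g x"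
    and fw: "\<forall>\<^sub>F n in sequentially. double_well (f n) (m n)"
    and gw: "double_well g a"
  shows "m \<longlonglongrightarrow> a"
proof (rule order_tendstoI)
  fix y assume "y < a"
  define z where "z = max y (a / 2)"
  have z: "0 < z" "z < a" "y \<le> z" using \<open>y < a\<close> double_well_pos[OF gw] by (auto simp: z_def)
  have "\<forall>\<^sub>F n in sequentially. f n a - f n z < 0"
    using z double_well_less(1)[OF gw, of z a]
    by (intro order_tendstoD[OF tendsto_diff[OF f f]]) auto
  with fw show "\<forall>\<^sub>F n in sequentially. y < m n"
  proof eventually_elim
    case (elim n)
    show ?case
    proof (rule ccontr)
      assume "\<not> y < m n"
      then show False using double_well_le(2)[OF elim(1), of z a] z elim(2) by auto
    qed
  qed
next
  fix y assume "a < y"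
  have a: "0 < a" using double_well_pos[OF gw] .
  have "\<forall>\<^sub>F n in sequentially. f n a - f n y < 0"
    using \<open>a < y\<close> a double_well_less(2)[OF gw, of a y]
    by (intro order_tendstoD[OF tendsto_diff[OF f f]]) auto
  with fw show "\<forall>\<^sub>F n in sequentially. m n < y"
  proof eventually_elim
    case (elim n)
    show ?case
    proof (rule ccontr)
      assume "\<not> m n < y"
      then show False using double_well_le(1)[OF elim(1), of a y] a \<open>a < y\<close> elim(2) by auto
    qed
  qed
qed

text \<open>
  The possible limits of the rescaled free energy. The coefficients are normalized so that
  \<^term>\<open>q\<close> and \<^term>\<open>r\<close> are the limits, after rescaling, of the two small parameters that
  measure the distance from the tricritical point, see \<open>well_scaling_limit\<close> below.
\<close>

definition sextic :: "real \<Rightarrow> real \<Rightarrow> real \<Rightarrow> real" where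
  "sextic q r u = - q / 2 * u ^ 2 + 3 / 8 * r * u ^ 4 + 9 / 40 * u ^ 6"

lemma double_well_sextic:
  assumes "0 < q" "0 \<le> r"
  shows "\<exists>m. double_well (sextic q r) m"
proof -
  define s where "s x = - q + 3 / 2 * r * x ^ 2 + 27 / 20 * x ^ 4" for x :: real
  have "\<exists>x\<ge>0. x \<le> 1 + q \<and> s x = 0"
  proof (rule IVT)
    have "1 + q \<le> (1 + q) ^ 4" using assms self_le_power[of "1+q" 4] by auto
    moreover have "0 \<le> 3 / 2 * r * (1 + q) ^ 2" using assms by simp
    ultimately show "0 \<le> s (1 + q)" using assms unfolding s_def by linarith
  qed (use assms in \<open>auto simp: s_def\<close>)
  then obtain m where m: "0 \<le> m" "s m = 0" by auto
  have "m \<noteq> 0" using m assms by (auto simp: s_def)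
  have "double_well (sextic q r) m"
  proof (rule double_wellI[where s = s and p = "\<lambda>x. x"])
    show "(sextic q r has_real_derivative x * s x) (at x)" for x
      unfolding sextic_def[abs_def] s_def
      by (rule derivative_eq_intros refl)+ (simp add: power2_eq_square power4_eq_xxxx algebra_simps eval_nat_numeral)
    show "continuous_on {0..} (sextic q r)"
      unfolding sextic_def by (intro continuous_intros)
    show "strict_mono_on {0<..} s"
    proof (rule monotone_onI)
      fix x y :: real assume "x \<in> {0<..}" "y \<in> {0<..}" "x < y"
      then have "x ^ 2 \<le> y ^ 2" "x ^ 4 < y ^ 4" by (auto intro: power_mono power_strict_mono)
      moreover from this have "3 / 2 * r * x ^ 2 \<le> 3 / 2 * r * y ^ 2"
        using assms by (intro mult_left_mono) auto
      ultimately show "s x < s y" unfolding s_def by linarith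
    qed
  qed (use m \<open>m \<noteq> 0\<close> in \<open>auto simp: sextic_def\<close>)
  then show ?thesis ..
qed

section \<open>The free energy as a function of two parameters\<close>

lemma nonneg_by_deriv:
  fixes f f' :: "real \<Rightarrow> real"
  assumes "\<And>x. (f has_real_derivative f' x) (at x)"
    and "\<And>x. 0 \<le> x \<Longrightarrow> 0 \<le> f' x" and "f 0 = 0" and "0 \<le> t"
  shows "0 \<le> f t"
proof -
  have "f 0 \<le> f t"
    using assms by (intro DERIV_nonneg_imp_nondecreasing[where f = f]) auto
  then show ?thesis using assms by simp
qed

lemma sinh_ge_self: "t \<le> sinh t" if "0 \<le> t" for t :: real
proof -
  have "0 \<le> sinh t - t"
    by (rule nonneg_by_deriv[where f = "\<lambda>t. sinh t - t" and f' = "\<lambda>t. cosh t - 1"])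
       (auto intro!: derivative_eq_intros simp: that cosh_real_ge_1)
  then show ?thesis by simp
qed

text \<open>
  The right-hand sides have power series at 0 with nonnegative coefficients, and the left-hand
  sides are their leading terms. Starting from \<open>t \<le> sinh t\<close>, each bound follows by integrating an
  earlier one.
\<close>

lemma hyperbolic_lower_bounds:
  fixes t :: real
  assumes "0 \<le> t"
  shows "t ^ 3 / 3 \<le> t * cosh t - sinh t"
    and "t ^ 4 / 12 \<le> t * sinh t - 2 * cosh t + 2"
    and "t ^ 5 / 60 \<le> t * cosh t - 3 * sinh t + 2 * t"
    and "t ^ 6 / 360 \<le> t * sinh t - 4 * cosh t + t ^ 2 + 4"
proof -
  have 0: "0 \<le> t * cosh t - sinh t - t ^ 3 / 3" if "0 \<le> t" for t :: real
  proof (rule nonneg_by_deriv[where f = "\<lambda>t. t * cosh t - sinh t - t ^ 3 / 3" and f' = "\<lambda>t. t * (sinh t - t)"])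
    show "((\<lambda>t. t * cosh t - sinh t - t ^ 3 / 3) has_real_derivative t * (sinh t - t)) (at t)" for t :: real
      by (auto intro!: derivative_eq_intros simp: field_simps power2_eq_square)
    show "0 \<le> t * (sinh t - t)" if "0 \<le> t" for t :: real
      using sinh_ge_self[OF that] that by simp
  qed (use that in simp_all)
  have 1: "0 \<le> t * sinh t - 2 * cosh t + 2 - t ^ 4 / 12" if "0 \<le> t" for t :: real
  proof (rule nonneg_by_deriv[where f = "\<lambda>t. t * sinh t - 2 * cosh t + 2 - t ^ 4 / 12" and f' = "\<lambda>t. t * cosh t - sinh t - t ^ 3 / 3"])
    show "((\<lambda>t. t * sinh t - 2 * cosh t + 2 - t ^ 4 / 12) has_real_derivative t * cosh t - sinh t - t ^ 3 / 3) (at t)" for t :: real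
      by (auto intro!: derivative_eq_intros simp: field_simps power2_eq_square)
    show "0 \<le> t * cosh t - sinh t - t ^ 3 / 3" if "0 \<le> t" for t :: real
      using 0[OF that] .
  qed (use that in simp_all)
  have 2: "0 \<le> t * cosh t - 3 * sinh t + 2 * t - t ^ 5 / 60" if "0 \<le> t" for t :: real
  proof (rule nonneg_by_deriv[where f = "\<lambda>t. t * cosh t - 3 * sinh t + 2 * t - t ^ 5 / 60" and f' = "\<lambda>t. t * sinh t - 2 * cosh t + 2 - t ^ 4 / 12"])
    show "((\<lambda>t. t * cosh t - 3 * sinh t + 2 * t - t ^ 5 / 60) has_real_derivative t * sinh t - 2 * cosh t + 2 - t ^ 4 / 12) (at t)" for t :: real
      by (auto intro!: derivative_eq_intros simp: field_simps power2_eq_square)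
    show "0 \<le> t * sinh t - 2 * cosh t + 2 - t ^ 4 / 12" if "0 \<le> t" for t :: real
      using 1[OF that] .
  qed (use that in simp_all)
  have 3: "0 \<le> t * sinh t - 4 * cosh t + t ^ 2 + 4 - t ^ 6 / 360" if "0 \<le> t" for t :: real
  proof (rule nonneg_by_deriv[where f = "\<lambda>t. t * sinh t - 4 * cosh t + t ^ 2 + 4 - t ^ 6 / 360" and f' = "\<lambda>t. t * cosh t - 3 * sinh t + 2 * t - t ^ 5 / 60"])
    show "((\<lambda>t. t * sinh t - 4 * cosh t + t ^ 2 + 4 - t ^ 6 / 360) has_real_derivative t * cosh t - 3 * sinh t + 2 * t - t ^ 5 / 60) (at t)" for t :: real
      by (auto intro!: derivative_eq_intros simp: field_simps power2_eq_square)
    show "0 \<le> t * cosh t - 3 * sinh t + 2 * t - t ^ 5 / 60" if "0 \<le> t" for t :: real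
      using 2[OF that] .
  qed (use that in simp_all)
  show "t ^ 3 / 3 \<le> t * cosh t - sinh t"
    and "t ^ 4 / 12 \<le> t * sinh t - 2 * cosh t + 2"
    and "t ^ 5 / 60 \<le> t * cosh t - 3 * sinh t + 2 * t"
    and "t ^ 6 / 360 \<le> t * sinh t - 4 * cosh t + t ^ 2 + 4"
    using 0[OF assms] 1[OF assms] 2[OF assms] 3[OF assms] by linarith+
qed

text \<open>
  With \<open>a = exp \<beta> / 2\<close> and \<open>k = 2 \<beta> K\<close> the free energy is this function of \<open>t = k x\<close>. The
  tricritical point is \<open>a = 2\<close>, \<open>k = 3\<close>.
\<close>

definition well :: "real \<Rightarrow> real \<Rightarrow> real \<Rightarrow> real" where
  "well a k t = t ^ 2 / (2 * k) - ln ((a + cosh t) / (a + 1))"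

lemma free_energy_eq_well:
  "free_energy \<beta> K x = well (exp \<beta> / 2) (2 * \<beta> * K) (2 * \<beta> * K * x)"
proof -
  have "(1 + exp (- \<beta>) * (exp t + exp (- t))) / (1 + 2 * exp (- \<beta>)) = (exp \<beta> / 2 + cosh t) / (exp \<beta> / 2 + 1)" for t
  proof -
    have *: "exp (- \<beta>) = 1 / exp \<beta>" by (simp add: exp_minus field_simps)
    have "exp \<beta> > 0" by simp
    then show ?thesis unfolding * cosh_field_def by (simp add: divide_simps) (simp add: algebra_simps)
  qed
  moreover have "\<beta> * K * x\<^sup>2 = (2 * \<beta> * K * x)\<^sup>2 / (2 * (2 * \<beta> * K))"
    by (simp add: power2_eq_square)
  ultimately show ?thesis by (simp add: free_energy_def c_fun_def well_def)
qed

lemma well_even: "well a k (- t) = well a k t"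
  by (simp add: well_def)

lemma well_zero: "0 < a \<Longrightarrow> well a k 0 = 0"
  by (simp add: well_def)

text \<open>
  The numerator of the derivative of \<^const>\<open>well\<close>, namely \<open>a t + t cosh t - k sinh t\<close>, sorted
  by orders of vanishing 1, 3 and 5 at 0. The coefficients \<open>k - a - 1\<close> and \<open>3 - k\<close> are the two
  small parameters near the tricritical point; the last term has no small coefficient and
  stabilizes the other two.
\<close>

definition slope :: "real \<Rightarrow> real \<Rightarrow> real \<Rightarrow> real" where
  "slope a k t = - (k - a - 1) * t + (3 - k) * (sinh t - t) + (t * cosh t - 3 * sinh t + 2 * t)"

lemma well_deriv:
  assumes "0 < a" "0 < k"
  shows "(well a k has_real_derivative slope a k t / (k * (a + cosh t))) (at t)"
proof -
  have pos: "0 < a + cosh t" for t using assms(1) by (simp add: add_pos_pos)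
  have "((\<lambda>t. t ^ 2 / (2 * k) - (ln (a + cosh t) - ln (a + 1))) has_real_derivative
          t / k - sinh t / (a + cosh t)) (at t)"
    using pos[of t] assms by (auto intro!: derivative_eq_intros)
  moreover have "well a k = (\<lambda>t. t ^ 2 / (2 * k) - (ln (a + cosh t) - ln (a + 1)))"
    using assms pos by (simp add: well_def fun_eq_iff ln_div less_imp_neq[symmetric])
  moreover have "t / k - sinh t / (a + cosh t) = slope a k t / (k * (a + cosh t))"
    using pos[of t] assms by (simp add: slope_def divide_simps) (simp add: algebra_simps)
  ultimately show ?thesis by simp
qed

text \<open>
  For \<^term>\<open>k \<le> 3\<close> all coefficients of the power series of \<open>slope a k t / t\<close> beyond the
  constant one are nonnegative, and that of \<open>t\<^sup>4\<close> is positive.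
\<close>

lemma slope_quotient_strict_mono:
  assumes "k \<le> 3"
  shows "strict_mono_on {0<..} (\<lambda>t. slope a k t / t)"
proof (rule monotone_onI)
  fix x y :: real assume xy: "x \<in> {0<..}" "y \<in> {0<..}" "x < y"
  show "slope a k x / x < slope a k y / y"
  proof (rule DERIV_pos_imp_increasing[OF \<open>x < y\<close>])
    fix t assume "x \<le> t" "t \<le> y"
    then have t: "0 < t" using xy by simp
    define D where "D = (3 - k) * (t * cosh t - sinh t) + (t * (t * sinh t) - 3 * (t * cosh t) + 3 * sinh t)"
    have "((\<lambda>t. slope a k t / t) has_real_derivative D / t ^ 2) (at t)"
      unfolding slope_def D_def using t
      by (auto intro!: derivative_eq_intros simp: field_simps power2_eq_square)
    moreover have "0 < D"
    proof -
      have *: "0 \<le> (s * (s * sinh s) - 3 * (s * cosh s) + 3 * sinh s) - s ^ 5 / 15" if "0 \<le> s" for s :: real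
      proof (rule nonneg_by_deriv[where f = "\<lambda>s. (s * (s * sinh s) - 3 * (s * cosh s) + 3 * sinh s) - s ^ 5 / 15" and f' = "\<lambda>s. s * (s * cosh s - sinh s - s ^ 3 / 3)"])
        show "((\<lambda>s. (s * (s * sinh s) - 3 * (s * cosh s) + 3 * sinh s) - s ^ 5 / 15) has_real_derivative s * (s * cosh s - sinh s - s ^ 3 / 3)) (at s)" for s :: real
          by (auto intro!: derivative_eq_intros simp: field_simps power2_eq_square eval_nat_numeral)
        show "0 \<le> s * (s * cosh s - sinh s - s ^ 3 / 3)" if "0 \<le> s" for s :: real
          using hyperbolic_lower_bounds(1)[OF that] that by simp
      qed (use that in simp_all)
      have "0 \<le> t * cosh t - sinh t"
        using hyperbolic_lower_bounds(1)[of t] zero_le_power[of t 3] t by linarith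
      then have "0 \<le> (3 - k) * (t * cosh t - sinh t)" using assms by simp
      moreover have "0 < t ^ 5 / 15" using t by simp
      ultimately show ?thesis using *[of t] t unfolding D_def by linarith
    qed
    ultimately show "\<exists>z. ((\<lambda>t. slope a k t / t) has_real_derivative z) (at t) \<and> 0 < z"
      using t by (intro exI[of _ "D / t ^ 2"]) simp
  qed
qed

text \<open>
  The condition \<^term>\<open>a + 1 < k\<close> says that the derivative starts out negative, that is,
  \<open>K\<close> exceeds the critical value \<^term>\<open>Kcrit \<beta>\<close>. Since \<open>slope a k t / t\<close> increases, it has a
  single zero.
\<close>

lemma double_well_well:
  assumes "0 < a" "a + 1 < k" "k \<le> 3"
  shows "\<exists>m. double_well (well a k) m"
proof -
  define s where "s t = slope a k t / t" for t
  have cont: "continuous_on {0<..} s"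
    unfolding s_def slope_def by (intro continuous_intros) auto
  have lim0: "((\<lambda>t. - (k - a - 1) + (3 - k) * ((sinh t - t) / t) + ((t * cosh t - 3 * sinh t + 2 * t) / t))
                \<longlongrightarrow> - (k - a - 1) + (3 - k) * 0 + 0) (at_right 0)"
  proof (intro tendsto_add tendsto_mult tendsto_const)
    show "((\<lambda>t::real. (sinh t - t) / t) \<longlongrightarrow> 0) (at_right 0)" by real_asymp
    show "((\<lambda>t::real. (t * cosh t - 3 * sinh t + 2 * t) / t) \<longlongrightarrow> 0) (at_right 0)" by real_asymp
  qed
  then have "\<forall>\<^sub>F t in at_right 0. - (k - a - 1) + (3 - k) * ((sinh t - t) / t) + ((t * cosh t - 3 * sinh t + 2 * t) / t) < 0"
    using assms by (intro order_tendstoD(2)[OF lim0]) auto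
  then have "\<forall>\<^sub>F t in at_right 0. s t < 0 \<and> 0 < t"
    using eventually_at_right_less[of 0]
  proof eventually_elim
    case (elim t)
    then have "s t = - (k - a - 1) + (3 - k) * ((sinh t - t) / t) + ((t * cosh t - 3 * sinh t + 2 * t) / t)"
      by (simp add: s_def slope_def add_divide_distrib)
    with elim show ?case by simp
  qed
  then obtain x where x: "0 < x" "s x < 0"
    using eventually_happens'[OF trivial_limit_at_right_real] by blast
  have big: "0 \<le> s t" if t: "x \<le> t" "3 \<le> t" for t
  proof -
    have "k * sinh t \<le> t * cosh t"
      using assms t sinh_le_cosh_real[of t] by (intro mult_mono) auto
    moreover have "slope a k t = a * t + (t * cosh t - k * sinh t)"
      by (simp add: slope_def algebra_simps)
    moreover have "0 \<le> a * t" using assms t by simp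
    ultimately have "0 \<le> slope a k t" by linarith
    then show ?thesis using t by (simp add: s_def)
  qed
  have "\<exists>m\<ge>x. m \<le> max x 3 \<and> s m = 0"
    by (rule IVT') (use x big in \<open>auto intro: continuous_on_subset[OF cont]\<close>)
  then obtain m where m: "0 < m" "s m = 0" using x by (meson less_le_trans)
  have "double_well (well a k) m"
  proof (rule double_wellI[where s = s and p = "\<lambda>t. t / (k * (a + cosh t))"])
    show "(well a k has_real_derivative t / (k * (a + cosh t)) * s t) (at t)" if "0 < t" for t
      using well_deriv[of a k t] assms that by (simp add: s_def)
    show "continuous_on {0..} (well a k)"
      using well_deriv[of a k] assms
      by (intro continuous_at_imp_continuous_on ballI DERIV_isCont) auto
    show "strict_mono_on {0<..} s"
      using slope_quotient_strict_mono[OF assms(3), of a] by (simp add: s_def[abs_def])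
  qed (use m assms in \<open>auto simp: well_even add_pos_pos\<close>)
  then show ?thesis ..
qed

text \<open>
  Integrating \<open>well'\<close> between 0 and \<^term>\<open>t\<close>, with the denominator \<open>a + cosh s\<close> replaced by its
  extreme values \<^term>\<open>a + 1\<close> and \<^term>\<open>a + cosh t\<close>: the positive and the negative part of the
  numerator take opposite extremes. Both bounds have the same leading behaviour at 0.
\<close>

lemma well_sandwich:
  assumes a: "0 < a" "a + 1 \<le> k" "k \<le> 3" and t: "0 \<le> t"
  defines "q \<equiv> k - a - 1"
    and "R \<equiv> (\<lambda>t. (3 - k) * (cosh t - 1 - t ^ 2 / 2) + (t * sinh t - 4 * cosh t + t ^ 2 + 4))"
  shows "R t / (a + cosh t) - q / (a + 1) * (t ^ 2 / 2) \<le> k * well a k t"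
    and "k * well a k t \<le> R t / (a + 1) - q / (a + cosh t) * (t ^ 2 / 2)"
proof -
  (* The right end point is kept fixed while the variable t runs over the interval up to it. *)
  define T where "T = t"
  have k: "0 < k" using a by simp
  define R' where "R' = (\<lambda>t. (3 - k) * (sinh t - t) + (t * cosh t - 3 * sinh t + 2 * t))"
  have R: "(R has_real_derivative R' t) (at t)" for t
    unfolding R_def R'_def by (auto intro!: derivative_eq_intros simp: field_simps)
  have R'_nonneg: "0 \<le> R' t" if "0 \<le> t" for t
  proof -
    have "0 \<le> t ^ 5 / 60" using that by simp
    moreover have "0 \<le> (3 - k) * (sinh t - t)" using a sinh_ge_self[OF that] by simp
    ultimately show ?thesis unfolding R'_def
      using hyperbolic_lower_bounds(3)[OF that] by linarith
  qed
  have W: "((\<lambda>t. k * well a k t) has_real_derivative (R' t - q * t) / (a + cosh t)) (at t)" for t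
  proof -
    have "slope a k t = R' t - q * t" by (simp add: slope_def R'_def q_def algebra_simps)
    then show ?thesis using DERIV_cmult[OF well_deriv[OF a(1) k, of t], of k] k by simp
  qed
  have q: "0 \<le> q" using a by (simp add: q_def)
  have sq: "((\<lambda>t. t ^ 2 / 2) has_real_derivative t) (at t)" for t :: real
    by (auto intro!: derivative_eq_intros)
  have R0: "R 0 = 0" by (simp add: R_def)
  have den: "a + 1 \<le> a + cosh s" "a + cosh s \<le> a + cosh T" if "0 \<le> s" "s \<le> T" for s
    using that by (auto simp: cosh_real_ge_1 cosh_real_nonneg_le_iff)
  have "R T / (a + cosh T) - q / (a + 1) * (T ^ 2 / 2) - k * well a k T
          \<le> R 0 / (a + cosh T) - q / (a + 1) * (0 ^ 2 / 2) - k * well a k 0"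
  proof (rule DERIV_nonpos_imp_nonincreasing[where f = "\<lambda>t. R t / (a + cosh T) - q / (a + 1) * (t ^ 2 / 2) - k * well a k t"])
    show "0 \<le> T" using t by (simp add: T_def)
    fix s assume s: "0 \<le> s" "s \<le> T"
    have "R' s / (a + cosh T) \<le> R' s / (a + cosh s)"
      using den[OF s] a R'_nonneg[OF s(1)] by (intro divide_left_mono) (auto intro!: mult_pos_pos add_pos_pos)
    moreover have "q * s / (a + cosh s) \<le> q * s / (a + 1)"
      using den[OF s] a q s by (intro divide_left_mono) (auto intro!: mult_pos_pos add_pos_pos)
    ultimately have "R' s / (a + cosh T) - q / (a + 1) * s - (R' s - q * s) / (a + cosh s) \<le> 0"
      by (simp add: diff_divide_distrib)
    moreover have "((\<lambda>t. R t / (a + cosh T) - q / (a + 1) * (t ^ 2 / 2) - k * well a k t)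
        has_real_derivative R' s / (a + cosh T) - q / (a + 1) * s - (R' s - q * s) / (a + cosh s)) (at s)"
      by (rule DERIV_diff[OF DERIV_diff[OF DERIV_cdivide[OF R] DERIV_cmult[OF sq]] W])
    ultimately show "\<exists>y. ((\<lambda>t. R t / (a + cosh T) - q / (a + 1) * (t ^ 2 / 2) - k * well a k t)
        has_real_derivative y) (at s) \<and> y \<le> 0" by blast
  qed
  then show "R t / (a + cosh t) - q / (a + 1) * (t ^ 2 / 2) \<le> k * well a k t"
    using R0 well_zero[OF a(1)] by (simp add: T_def)
  have "k * well a k T - (R T / (a + 1) - q / (a + cosh T) * (T ^ 2 / 2))
          \<le> k * well a k 0 - (R 0 / (a + 1) - q / (a + cosh T) * (0 ^ 2 / 2))"
  proof (rule DERIV_nonpos_imp_nonincreasing[where f = "\<lambda>t. k * well a k t - (R t / (a + 1) - q / (a + cosh T) * (t ^ 2 / 2))"])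
    show "0 \<le> T" using t by (simp add: T_def)
    fix s assume s: "0 \<le> s" "s \<le> T"
    have "R' s / (a + cosh s) \<le> R' s / (a + 1)"
      using den[OF s] a R'_nonneg[OF s(1)] by (intro divide_left_mono) (auto intro!: mult_pos_pos add_pos_pos)
    moreover have "q * s / (a + cosh T) \<le> q * s / (a + cosh s)"
      using den[OF s] a q s by (intro divide_left_mono) (auto intro!: mult_pos_pos add_pos_pos)
    ultimately have "(R' s - q * s) / (a + cosh s) - (R' s / (a + 1) - q / (a + cosh T) * s) \<le> 0"
      by (simp add: diff_divide_distrib)
    moreover have "((\<lambda>t. k * well a k t - (R t / (a + 1) - q / (a + cosh T) * (t ^ 2 / 2)))
        has_real_derivative (R' s - q * s) / (a + cosh s) - (R' s / (a + 1) - q / (a + cosh T) * s)) (at s)"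
      by (rule DERIV_diff[OF W DERIV_diff[OF DERIV_cdivide[OF R] DERIV_cmult[OF sq]]])
    ultimately show "\<exists>y. ((\<lambda>t. k * well a k t - (R t / (a + 1) - q / (a + cosh T) * (t ^ 2 / 2)))
        has_real_derivative y) (at s) \<and> y \<le> 0" by blast
  qed
  then show "k * well a k t \<le> R t / (a + 1) - q / (a + cosh t) * (t ^ 2 / 2)"
    using R0 well_zero[OF a(1)] by (simp add: T_def)
qed

section \<open>Scaling limit and coercivity of the free energy\<close>

text \<open>
  At distance \<open>\<delta> u\<close> from 0 the three terms of \<^const>\<open>slope\<close> contribute to the free energy amounts
  of orders \<open>(k - a - 1) \<delta>\<^sup>2\<close>, \<open>(3 - k) \<delta>\<^sup>4\<close> and \<open>\<delta>\<^sup>6\<close>. They balance at the scale \<open>\<delta>\<^sup>6\<close> precisely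
  under the assumptions on the two small parameters.
\<close>

lemma well_scaling_limit:
  fixes a k \<delta> :: "nat \<Rightarrow> real"
  assumes a: "a \<longlonglongrightarrow> 2" and k: "k \<longlonglongrightarrow> 3" and \<delta>: "\<delta> \<longlonglongrightarrow> 0"
    and ev: "\<forall>\<^sub>F n in sequentially. 0 < \<delta> n \<and> a n + 1 \<le> k n \<and> k n \<le> 3"
    and q: "(\<lambda>n. (k n - a n - 1) / \<delta> n ^ 4) \<longlonglongrightarrow> q"
    and r: "(\<lambda>n. (3 - k n) / \<delta> n ^ 2) \<longlonglongrightarrow> r"
  shows "(\<lambda>n. well (a n) (k n) (k n * (\<delta> n * u)) / \<delta> n ^ 6) \<longlonglongrightarrow> sextic q r u"
proof -
  have a0: "\<forall>\<^sub>F n in sequentially. 0 < a n" using a by (rule order_tendstoD) simp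
  have pos: "(\<lambda>n. well (a n) (k n) (k n * (\<delta> n * u)) / \<delta> n ^ 6) \<longlonglongrightarrow> sextic q r u"
    if u: "0 < u" for u
  proof -
    define T where "T n = k n * (\<delta> n * u)" for n
    define P where "P t = cosh t - 1 - t ^ 2 / 2" for t :: real
    define Q where "Q t = t * sinh t - 4 * cosh t + t ^ 2 + 4" for t :: real
    define S where "S n = ((3 - k n) * P (T n) + Q (T n)) / \<delta> n ^ 6" for n
    define V where "V n = k n * well (a n) (k n) (T n) / \<delta> n ^ 6" for n
    have T_pos: "\<forall>\<^sub>F n in sequentially. 0 < T n"
      using ev a0 by eventually_elim (use u in \<open>auto simp: T_def\<close>)
    have "T \<longlonglongrightarrow> 3 * (0 * u)"
      unfolding T_def by (intro tendsto_intros k \<delta>)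
    then have T0: "T \<longlonglongrightarrow> 0" by simp
    with T_pos have T: "filterlim T (at_right 0) sequentially"
      by (auto simp: filterlim_at elim: eventually_mono)
    have cosh: "(\<lambda>n. cosh (T n)) \<longlonglongrightarrow> 1"
      using tendsto_cosh[OF T0] by simp
    have P: "(\<lambda>n. P (T n) / T n ^ 4) \<longlonglongrightarrow> 1 / 24"
      by (rule filterlim_compose[OF _ T]) (unfold P_def, real_asymp)
    have Q: "(\<lambda>n. Q (T n) / T n ^ 6) \<longlonglongrightarrow> 1 / 360"
      by (rule filterlim_compose[OF _ T]) (unfold Q_def, real_asymp)
    have "(\<lambda>n. (3 - k n) / \<delta> n ^ 2 * (P (T n) / T n ^ 4) * (k n * u) ^ 4 + Q (T n) / T n ^ 6 * (k n * u) ^ 6)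
        \<longlonglongrightarrow> r * (1 / 24) * (3 * u) ^ 4 + 1 / 360 * (3 * u) ^ 6"
      by (intro tendsto_intros r P Q k)
    moreover have "\<forall>\<^sub>F n in sequentially.
        (3 - k n) / \<delta> n ^ 2 * (P (T n) / T n ^ 4) * (k n * u) ^ 4 + Q (T n) / T n ^ 6 * (k n * u) ^ 6 = S n"
      using ev T_pos
    proof eventually_elim
      case (elim n)
      have *: "k n * u = T n / \<delta> n" using elim by (simp add: T_def)
      show ?case unfolding * S_def using elim
        by (simp add: power_divide divide_simps)
    qed
    ultimately have S: "S \<longlonglongrightarrow> r * (1 / 24) * (3 * u) ^ 4 + 1 / 360 * (3 * u) ^ 6"
      by (rule Lim_transform_eventually)
    have "V \<longlonglongrightarrow> (r * (1 / 24) * (3 * u) ^ 4 + 1 / 360 * (3 * u) ^ 6) / (2 + 1) - q / (2 + 1) * ((3 * u) ^ 2 / 2)"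
      (is "_ \<longlonglongrightarrow> ?L")
    proof (rule tendsto_sandwich)
      show "(\<lambda>n. S n / (a n + cosh (T n)) - (k n - a n - 1) / \<delta> n ^ 4 / (a n + 1) * ((k n * u) ^ 2 / 2)) \<longlonglongrightarrow> ?L"
        by (intro tendsto_intros S a q k cosh) auto
      show "(\<lambda>n. S n / (a n + 1) - (k n - a n - 1) / \<delta> n ^ 4 / (a n + cosh (T n)) * ((k n * u) ^ 2 / 2)) \<longlonglongrightarrow> ?L"
        by (intro tendsto_intros S a q k cosh) auto
      have split: "(X / Y - q' / Z * (T n ^ 2 / 2)) / \<delta> n ^ 6 = X / \<delta> n ^ 6 / Y - q' / \<delta> n ^ 4 / Z * ((k n * u) ^ 2 / 2)"
        if "0 < \<delta> n" for X Y Z q' n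
      proof -
        have "T n ^ 2 / \<delta> n ^ 6 = (k n * u) ^ 2 / \<delta> n ^ 4"
          using that by (simp add: T_def power_mult_distrib divide_simps flip: power_add)
        then have "q' / Z / 2 * (T n ^ 2 / \<delta> n ^ 6) = q' / Z / 2 * ((k n * u) ^ 2 / \<delta> n ^ 4)" by simp
        then show ?thesis by (simp add: diff_divide_distrib mult.commute)
      qed
      show "\<forall>\<^sub>F n in sequentially. S n / (a n + cosh (T n)) - (k n - a n - 1) / \<delta> n ^ 4 / (a n + 1) * ((k n * u) ^ 2 / 2) \<le> V n"
        using ev a0 T_pos
      proof eventually_elim
        case (elim n)
        then have \<delta>n: "0 < \<delta> n" "0 \<le> \<delta> n ^ 6" by auto
        have "0 < a n" "a n + 1 \<le> k n" "k n \<le> 3" "0 \<le> T n" using elim by auto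
        from divide_right_mono[OF well_sandwich(1)[OF this] \<delta>n(2)]
        show ?case unfolding split[OF \<delta>n(1)] V_def S_def P_def Q_def .
      qed
      show "\<forall>\<^sub>F n in sequentially. V n \<le> S n / (a n + 1) - (k n - a n - 1) / \<delta> n ^ 4 / (a n + cosh (T n)) * ((k n * u) ^ 2 / 2)"
        using ev a0 T_pos
      proof eventually_elim
        case (elim n)
        then have \<delta>n: "0 < \<delta> n" "0 \<le> \<delta> n ^ 6" by auto
        have "0 < a n" "a n + 1 \<le> k n" "k n \<le> 3" "0 \<le> T n" using elim by auto
        from divide_right_mono[OF well_sandwich(2)[OF this] \<delta>n(2)]
        show ?case unfolding split[OF \<delta>n(1)] V_def S_def P_def Q_def .
      qed
    qed
    then have "(\<lambda>n. V n / k n) \<longlonglongrightarrow> ?L / 3"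
      by (intro tendsto_divide k) auto
    moreover have "?L / 3 = sextic q r u"
      by (simp add: sextic_def power_mult_distrib field_simps)
    moreover have "\<forall>\<^sub>F n in sequentially. V n / k n = well (a n) (k n) (k n * (\<delta> n * u)) / \<delta> n ^ 6"
      using ev a0 by eventually_elim (auto simp: V_def T_def)
    ultimately show ?thesis by (auto intro: Lim_transform_eventually)
  qed
  consider "u = 0" | "0 < u" | "u < 0" by linarith
  then show ?thesis
  proof cases
    case 1
    have "\<forall>\<^sub>F n in sequentially. 0 = well (a n) (k n) (k n * (\<delta> n * u)) / \<delta> n ^ 6"
      using a0 by eventually_elim (simp add: 1 well_zero)
    then show ?thesis using 1 by (auto intro!: tendsto_eventually elim: eventually_mono simp: sextic_def)
  next
    case 3
    have "sextic q r (- u) = sextic q r u" by (simp add: sextic_def)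
    then show ?thesis using pos[of "- u"] 3 by (simp add: well_even)
  qed (rule pos)
qed

text \<open>
  A lower bound with a constant that is uniform in the parameters, so that it can dominate the
  integrands after rescaling. For bounded arguments the sextic term absorbs the negative
  quadratic one; for large arguments the free energy itself is of order \<open>t\<^sup>2\<close>, because the
  logarithm in \<^const>\<open>well\<close> is at most \<open>t\<close>.
\<close>

lemma well_coercive:
  fixes C :: real
  assumes "0 \<le> C"
  obtains B where "\<And>a k \<delta> u. 0 < a \<Longrightarrow> a \<le> 2 \<Longrightarrow> 2 \<le> k \<Longrightarrow> a + 1 \<le> k \<Longrightarrow> k \<le> 3 \<Longrightarrow> 0 < \<delta> \<Longrightarrow> 6 * \<delta> ^ 4 \<le> 1 \<Longrightarrow>
     k - a - 1 \<le> C * \<delta> ^ 4 \<Longrightarrow> u ^ 2 - B \<le> well a k (k * (\<delta> * u)) / \<delta> ^ 6"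
proof -
  (* The threshold 8 makes t^2 / 6 - t at least t^2 / 24 beyond it. Below it, 2 + cosh 8 bounds
     the denominator in the sandwich, 64 = 2^6 comes from k >= 2, and the division by 3 from
     k <= 3. M collects the negative quadratic term and the u^2 of the claim. *)
  define c\<^sub>0 :: real where "c\<^sub>0 = 64 / 360 / (2 + cosh 8)"
  define c where "c = c\<^sub>0 / 3"
  define M where "M = 9 / 2 * C + 1"
  define B where "B = M * (1 + M / c)"
  have c: "0 < c" by (simp add: c_def c\<^sub>0_def add_pos_pos)
  have M: "1 \<le> M" using assms by (simp add: M_def)
  have B: "0 \<le> B" using M c by (simp add: B_def)
  have cubic: "M * s - B \<le> c * s ^ 3" if "0 \<le> s" for s
  proof (cases "s \<le> 1 + M / c")
    case True
    then have "M * s \<le> B" using M unfolding B_def by (intro mult_left_mono) auto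
    moreover have "0 \<le> c * s ^ 3" using that c by simp
    ultimately show ?thesis by linarith
  next
    case False
    then have s: "1 \<le> s" "M / c \<le> s" using M c by (smt (verit) divide_pos_pos)+
    have "M \<le> c * s" using s(2) c by (simp add: field_simps)
    also have "\<dots> \<le> c * s * s" using s c by simp
    finally have "M * s \<le> c * s * s * s" using s by (intro mult_right_mono) auto
    also have "c * s * s * s = c * s ^ 3" by (simp add: power3_eq_cube)
    finally show ?thesis using B by linarith
  qed
  have "u ^ 2 - B \<le> well a k (k * (\<delta> * u)) / \<delta> ^ 6"
    if ak: "0 < a" "a \<le> 2" "2 \<le> k" "a + 1 \<le> k" "k \<le> 3" and \<delta>: "0 < \<delta>" "6 * \<delta> ^ 4 \<le> 1"
      and q: "k - a - 1 \<le> C * \<delta> ^ 4" for a k \<delta> u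
  proof -
    define T where "T = k * \<delta> * \<bar>u\<bar>"
    have T: "0 \<le> T" using ak \<delta> by (simp add: T_def)
    have T_ge: "2 * (\<delta> * \<bar>u\<bar>) \<le> T" and T_le: "T \<le> 3 * (\<delta> * \<bar>u\<bar>)"
      using ak \<delta> by (auto simp: T_def mult.assoc intro!: mult_right_mono)
    have wT: "well a k (k * (\<delta> * u)) = well a k T"
      using ak \<delta> well_even[of a k "k * (\<delta> * u)"] by (cases "0 \<le> u") (simp_all add: T_def mult.assoc)
    have "\<delta> ^ 6 * (u ^ 2 - B) \<le> well a k T"
    proof (cases "T \<le> 8")
      case True
      have "0 \<le> cosh T - 1 - T ^ 2 / 2"
      proof (rule nonneg_by_deriv[where f = "\<lambda>t. cosh t - 1 - t ^ 2 / 2" and f' = "\<lambda>t. sinh t - t"])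
        show "((\<lambda>t. cosh t - 1 - t ^ 2 / 2) has_real_derivative sinh t - t) (at t)" for t :: real
          by (auto intro!: derivative_eq_intros)
      qed (use T in \<open>auto simp: sinh_ge_self\<close>)
      then have "0 \<le> (3 - k) * (cosh T - 1 - T ^ 2 / 2)" using ak by simp
      then have R: "T ^ 6 / 360 \<le> (3 - k) * (cosh T - 1 - T ^ 2 / 2) + (T * sinh T - 4 * cosh T + T ^ 2 + 4)"
        using hyperbolic_lower_bounds(4)[OF T] by linarith
      have "cosh T \<le> cosh 8" using True T by (simp add: cosh_real_nonneg_le_iff)
      have "64 * (\<delta> * \<bar>u\<bar>) ^ 6 \<le> T ^ 6"
        using power_mono[OF T_ge, of 6] \<delta> by (simp add: power_mult_distrib)
      then have "64 * (\<delta> * \<bar>u\<bar>) ^ 6 / 360 / (2 + cosh 8) \<le> T ^ 6 / 360 / (2 + cosh 8)"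
        by (intro divide_right_mono) (auto simp: add_nonneg_nonneg)
      moreover have "64 * (\<delta> * \<bar>u\<bar>) ^ 6 / 360 / (2 + cosh 8) = 3 * c * (\<delta> * \<bar>u\<bar>) ^ 6"
        unfolding c_def c\<^sub>0_def by (simp add: divide_simps)
      ultimately have "3 * c * (\<delta> * \<bar>u\<bar>) ^ 6 \<le> T ^ 6 / 360 / (2 + cosh 8)" by simp
      also have "\<dots> \<le> T ^ 6 / 360 / (a + cosh T)"
        using ak T \<open>cosh T \<le> cosh 8\<close> by (intro divide_left_mono) (auto simp: add_pos_pos)
      also have "\<dots> \<le> ((3 - k) * (cosh T - 1 - T ^ 2 / 2) + (T * sinh T - 4 * cosh T + T ^ 2 + 4)) / (a + cosh T)"
        using ak by (intro divide_right_mono R) (simp add: add_nonneg_nonneg)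
      also have "\<dots> \<le> k * well a k T + (k - a - 1) / (a + 1) * (T ^ 2 / 2)"
        using well_sandwich(1)[OF ak(1) ak(4) ak(5) T] by linarith
      also have "(k - a - 1) / (a + 1) * (T ^ 2 / 2) \<le> C * \<delta> ^ 4 * ((3 * (\<delta> * \<bar>u\<bar>)) ^ 2 / 2)"
      proof (rule mult_mono)
        have "(k - a - 1) / (a + 1) \<le> (k - a - 1) / 1" using ak by (intro divide_left_mono) auto
        then show "(k - a - 1) / (a + 1) \<le> C * \<delta> ^ 4" using q by simp
        show "T ^ 2 / 2 \<le> (3 * (\<delta> * \<bar>u\<bar>)) ^ 2 / 2"
          using power_mono[OF T_le T, of 2] by simp
      qed (use assms in auto)
      finally have 1: "3 * c * (\<delta> * \<bar>u\<bar>) ^ 6 \<le> k * well a k T + C * \<delta> ^ 4 * ((3 * (\<delta> * \<bar>u\<bar>)) ^ 2 / 2)" by simp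
      have e1: "(\<delta> * \<bar>u\<bar>) ^ 6 = \<delta> ^ 6 * (u\<^sup>2) ^ 3"
        by (simp add: power_mult_distrib flip: power_mult)
      have e2: "C * \<delta> ^ 4 * ((3 * (\<delta> * \<bar>u\<bar>)) ^ 2 / 2) = \<delta> ^ 6 * (9 / 2 * C * u\<^sup>2)"
        by (simp add: power_mult_distrib flip: power_add)
      have "k * c * (\<delta> ^ 6 * (u\<^sup>2) ^ 3) \<le> 3 * c * (\<delta> ^ 6 * (u\<^sup>2) ^ 3)"
        using ak c \<delta> by (intro mult_right_mono) auto
      moreover have "\<delta> ^ 6 * (9 / 2 * C * u\<^sup>2) \<le> k * (\<delta> ^ 6 * (9 / 2 * C * u\<^sup>2))"
        using mult_right_mono[of 1 k "\<delta> ^ 6 * (9 / 2 * C * u\<^sup>2)"] ak assms \<delta> by simp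
      ultimately have "k * (c * (\<delta> ^ 6 * (u\<^sup>2) ^ 3)) \<le> k * (well a k T + \<delta> ^ 6 * (9 / 2 * C * u\<^sup>2))"
        using 1 unfolding e1 e2 by (simp add: algebra_simps)
      then have "c * (\<delta> ^ 6 * (u\<^sup>2) ^ 3) \<le> well a k T + \<delta> ^ 6 * (9 / 2 * C * u\<^sup>2)"
        using ak by simp
      moreover have "\<delta> ^ 6 * (M * u\<^sup>2 - B) \<le> \<delta> ^ 6 * (c * (u\<^sup>2) ^ 3)"
        using cubic[of "u\<^sup>2"] \<delta> by (intro mult_left_mono) auto
      ultimately show ?thesis by (simp add: M_def algebra_simps)
    next
      case False
      have "(a + cosh T) / (a + 1) \<le> exp T"
      proof -
        have "a * 1 \<le> a * cosh T" using ak by (intro mult_left_mono) (auto simp: cosh_real_ge_1)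
        then have "a + cosh T \<le> cosh T * (a + 1)" by (simp add: algebra_simps)
        then have "(a + cosh T) / (a + 1) \<le> cosh T" using ak by (simp add: pos_divide_le_eq)
        also have "\<dots> \<le> exp T" using T by (simp flip: cosh_plus_sinh)
        finally show ?thesis .
      qed
      then have "ln ((a + cosh T) / (a + 1)) \<le> T"
        using ak by (smt (verit) add_pos_pos cosh_real_pos divide_pos_pos ln_exp ln_le_cancel_iff exp_gt_zero)
      moreover have "T ^ 2 / 6 \<le> T ^ 2 / (2 * k)"
        using ak by (intro divide_left_mono) auto
      moreover have "8 * T \<le> T ^ 2" using False by (simp add: power2_eq_square)
      ultimately have "T ^ 2 / 24 \<le> well a k T" unfolding well_def by linarith
      moreover have "(2 * (\<delta> * \<bar>u\<bar>)) ^ 2 \<le> T ^ 2"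
        using \<delta> by (intro power_mono T_ge) auto
      then have "\<delta> ^ 2 * u\<^sup>2 / 6 \<le> T ^ 2 / 24" by (simp add: power_mult_distrib)
      moreover have "\<delta> ^ 6 * u\<^sup>2 \<le> \<delta> ^ 2 * u\<^sup>2 / 6"
      proof -
        have "\<delta> ^ 6 * u\<^sup>2 = (\<delta> ^ 2 * u\<^sup>2) * \<delta> ^ 4" by (simp flip: power_add)
        also have "\<dots> \<le> (\<delta> ^ 2 * u\<^sup>2) * (1 / 6)" using \<delta> by (intro mult_left_mono) auto
        finally show ?thesis by simp
      qed
      moreover have "\<delta> ^ 6 * (u ^ 2 - B) \<le> \<delta> ^ 6 * u\<^sup>2" using B \<delta> by (intro mult_left_mono) auto
      ultimately show ?thesis by linarith
    qed
    then show ?thesis using \<delta> wT by (simp add: pos_le_divide_eq mult.commute)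
  qed
  then show ?thesis using that by blast
qed

section \<open>Laplace asymptotics of Gibbs averages\<close>

text \<open>
  For a coercive \<open>f\<close>, the integrands \<open>exp (- \<theta> f)\<close> and \<open>\<bar>u\<bar> exp (- \<theta> f)\<close> are dominated
  by multiples of these two functions.
\<close>

lemma integrable_gaussian:
  "integrable lborel (\<lambda>u::real. exp (- (u ^ 2)))"
  "integrable lborel (\<lambda>u::real. \<bar>u\<bar> * exp (- (u ^ 2)))"
proof -
  have *: "exp (- (u ^ 2)) = sqrt pi * normal_density 0 (1 / sqrt 2) u" for u :: real
    by (simp add: normal_density_def power_divide)
  show "integrable lborel (\<lambda>u::real. exp (- (u ^ 2)))"
    unfolding * by (intro integrable_mult_right integrable_normal_density) simp
  have "integrable lborel (\<lambda>u. normal_density 0 (1 / sqrt 2) u * \<bar>u - 0\<bar> ^ (2 * 0 + 1))"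
    by (rule integrable.intros[OF normal_moment_abs_odd]) simp
  then have "integrable lborel (\<lambda>u. sqrt pi * (normal_density 0 (1 / sqrt 2) u * \<bar>u\<bar>))"
    by (intro integrable_mult_right) simp
  then show "integrable lborel (\<lambda>u::real. \<bar>u\<bar> * exp (- (u ^ 2)))"
    unfolding * by (simp add: mult_ac)
qed

lemma integrable_coercive:
  fixes f :: "real \<Rightarrow> real"
  assumes f: "continuous_on UNIV f" and coercive: "\<And>u. u ^ 2 - B \<le> f u" and "1 \<le> \<theta>"
  shows "integrable lborel (\<lambda>u. exp (- \<theta> * f u))"
    and "integrable lborel (\<lambda>u. \<bar>u\<bar> * exp (- \<theta> * f u))"
proof -
  have [measurable]: "f \<in> borel_measurable borel"
    using f by (rule borel_measurable_continuous_onI)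
  have bound: "exp (- \<theta> * f u) \<le> exp (\<theta> * B) * exp (- (u ^ 2))" for u
  proof -
    have "\<theta> * (u ^ 2 - B) \<le> \<theta> * f u" using assms(3) by (intro mult_left_mono coercive) auto
    moreover have "1 * u ^ 2 \<le> \<theta> * u ^ 2" using assms(3) by (intro mult_right_mono) auto
    ultimately have "- \<theta> * f u \<le> \<theta> * B + - (u ^ 2)" by (simp add: algebra_simps)
    then show ?thesis by (simp flip: exp_add)
  qed
  show "integrable lborel (\<lambda>u. exp (- \<theta> * f u))"
    by (rule Bochner_Integration.integrable_bound[OF integrable_mult_right[OF integrable_gaussian(1), of "exp (\<theta> * B)"]])
       (use bound in auto)
  have "\<bar>u\<bar> * exp (- \<theta> * f u) \<le> exp (\<theta> * B) * (\<bar>u\<bar> * exp (- (u ^ 2)))" for u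
    using mult_left_mono[OF bound[of u], of "\<bar>u\<bar>"] by (simp add: mult_ac)
  then show "integrable lborel (\<lambda>u. \<bar>u\<bar> * exp (- \<theta> * f u))"
    by (intro Bochner_Integration.integrable_bound[OF integrable_mult_right[OF integrable_gaussian(2), of "exp (\<theta> * B)"]])
       auto
qed

lemma integral_pos_off_zero:
  fixes f :: "real \<Rightarrow> real"
  assumes f: "integrable lborel f" and pos: "\<And>x. x \<noteq> 0 \<Longrightarrow> 0 < f x" and nn: "0 \<le> f 0"
  shows "0 < (LINT x|lborel. f x)"
proof -
  have nn: "0 \<le> f x" for x using pos[of x] nn by (cases "x = 0") auto
  have "(LINT x|lborel. f x) \<noteq> 0"
  proof
    assume "(LINT x|lborel. f x) = 0"
    then have "AE x in lborel. f x = 0"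
      using integral_nonneg_eq_0_iff_AE[OF f] nn by simp
    moreover have "AE x in lborel. x \<noteq> (0::real)" by (rule AE_lborel_singleton)
    ultimately have "AE x in (lborel :: real measure). False"
      by eventually_elim (use pos in force)
    then show False by (simp add: eventually_False ae_filter_eq_bot_iff)
  qed
  then show ?thesis using Bochner_Integration.integral_nonneg[where f = f and M = lborel] nn by (simp add: le_less)
qed

text \<open>
  The mean absolute value under the density proportional to \<open>exp (- \<theta> f)\<close>. The numbers
  \<^const>\<open>y_bar\<close> and \<^const>\<open>z_bar\<close> are of this form with \<^term>\<open>\<theta> = 1\<close>.
\<close>

definition gibbs_abs_mean :: "real \<Rightarrow> (real \<Rightarrow> real) \<Rightarrow> real" where
  "gibbs_abs_mean \<theta> f = (LINT u|lborel. \<bar>u\<bar> * exp (- \<theta> * f u)) / (LINT u|lborel. exp (- \<theta> * f u))"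

lemma gibbs_abs_mean_pos:
  fixes f :: "real \<Rightarrow> real"
  assumes "continuous_on UNIV f" "\<And>u. u ^ 2 - B \<le> f u"
  shows "0 < gibbs_abs_mean 1 f"
  unfolding gibbs_abs_mean_def
  by (intro divide_pos_pos integral_pos_off_zero integrable_coercive[OF assms]) auto

lemma gibbs_abs_mean_rescale:
  assumes "0 < \<delta>" "b \<noteq> 0"
  shows "gibbs_abs_mean \<theta> f = \<delta> * gibbs_abs_mean (\<theta> * b) (\<lambda>u. f (\<delta> * u) / b)"
proof -
  have "(LINT u|lborel. \<bar>u\<bar> * exp (- \<theta> * f u)) = \<delta> * (LINT u|lborel. \<bar>\<delta> * u\<bar> * exp (- \<theta> * f (\<delta> * u)))"
    using lborel_integral_real_affine[of \<delta> "\<lambda>u. \<bar>u\<bar> * exp (- \<theta> * f u)" 0] assms by simp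
  also have "(LINT u|lborel. \<bar>\<delta> * u\<bar> * exp (- \<theta> * f (\<delta> * u))) = (LINT u|lborel. \<delta> * (\<bar>u\<bar> * exp (- \<theta> * f (\<delta> * u))))"
    using assms by (simp add: abs_mult mult.assoc)
  also have "\<dots> = \<delta> * (LINT u|lborel. \<bar>u\<bar> * exp (- \<theta> * f (\<delta> * u)))" by simp
  finally have 1: "(LINT u|lborel. \<bar>u\<bar> * exp (- \<theta> * f u)) = \<delta> * (\<delta> * (LINT u|lborel. \<bar>u\<bar> * exp (- \<theta> * f (\<delta> * u))))" .
  have 2: "(LINT u|lborel. exp (- \<theta> * f u)) = \<delta> * (LINT u|lborel. exp (- \<theta> * f (\<delta> * u)))"
    using lborel_integral_real_affine[of \<delta> "\<lambda>u. exp (- \<theta> * f u)" 0] assms by simp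
  show ?thesis unfolding gibbs_abs_mean_def 1 2 using assms by simp
qed

text \<open>
  Dominated convergence with the majorants \<open>exp B exp (- u\<^sup>2)\<close> and
  \<open>exp B \<bar>u\<bar> exp (- u\<^sup>2)\<close> provided by coercivity.
\<close>

lemma tendsto_gibbs_abs_mean:
  fixes f :: "nat \<Rightarrow> real \<Rightarrow> real"
  assumes f: "\<And>n. continuous_on UNIV (f n)" and g: "continuous_on UNIV g"
    and lim: "\<And>u. (\<lambda>n. f n u) \<longlonglongrightarrow> g u"
    and coercive: "\<forall>\<^sub>F n in sequentially. \<forall>u. u ^ 2 - B \<le> f n u"
  shows "(\<lambda>n. gibbs_abs_mean 1 (f n)) \<longlonglongrightarrow> gibbs_abs_mean 1 g"
proof -
  obtain N where N: "\<And>n u. n \<ge> N \<Longrightarrow> u ^ 2 - B \<le> f n u"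
    using coercive by (auto simp: eventually_sequentially)
  have [measurable]: "f n \<in> borel_measurable borel" "g \<in> borel_measurable borel" for n
    using f g by (auto intro: borel_measurable_continuous_onI)
  have bound: "exp (- 1 * f (n + N) u) \<le> exp B * exp (- (u ^ 2))" for n u
    using N[of "n + N" u] by (simp flip: exp_add)
  have g_bound: "u ^ 2 - B \<le> g u" for u
    by (rule LIMSEQ_le_const[OF lim]) (use N in blast)
  have 0: "(\<lambda>n. LINT u|lborel. exp (- 1 * f (n + N) u)) \<longlonglongrightarrow> (LINT u|lborel. exp (- 1 * g u))"
  proof (rule integral_dominated_convergence[where w = "\<lambda>u. exp B * exp (- (u ^ 2))"])
    show "AE u in lborel. (\<lambda>n. exp (- 1 * f (n + N) u)) \<longlonglongrightarrow> exp (- 1 * g u)"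
      by (intro AE_I2 tendsto_intros LIMSEQ_ignore_initial_segment lim)
    show "AE u in lborel. norm (exp (- 1 * f (n + N) u)) \<le> exp B * exp (- (u ^ 2))" for n
      using bound by simp
  qed (auto intro!: integrable_mult_right integrable_gaussian)
  have 1: "(\<lambda>n. LINT u|lborel. \<bar>u\<bar> * exp (- 1 * f (n + N) u)) \<longlonglongrightarrow> (LINT u|lborel. \<bar>u\<bar> * exp (- 1 * g u))"
  proof (rule integral_dominated_convergence[where w = "\<lambda>u. exp B * (\<bar>u\<bar> * exp (- (u ^ 2)))"])
    show "AE u in lborel. (\<lambda>n. \<bar>u\<bar> * exp (- 1 * f (n + N) u)) \<longlonglongrightarrow> \<bar>u\<bar> * exp (- 1 * g u)"
      by (intro AE_I2 tendsto_intros LIMSEQ_ignore_initial_segment lim)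
    show "AE u in lborel. norm (\<bar>u\<bar> * exp (- 1 * f (n + N) u)) \<le> exp B * (\<bar>u\<bar> * exp (- (u ^ 2)))" for n
      using mult_left_mono[OF bound, of "\<bar>u\<bar>" n u for u] by (auto simp: abs_mult mult_ac)
  qed (auto intro!: integrable_mult_right integrable_gaussian)
  have "0 < (LINT u|lborel. exp (- 1 * g u))"
    by (intro integral_pos_off_zero integrable_coercive[OF g g_bound]) auto
  then have "(\<lambda>n. gibbs_abs_mean 1 (f (n + N))) \<longlonglongrightarrow> gibbs_abs_mean 1 g"
    unfolding gibbs_abs_mean_def by (intro tendsto_divide 0 1) simp
  then show ?thesis by (rule LIMSEQ_offset)
qed

text \<open>
  Laplace's method. Near \<^term>\<open>a\<close> the functions \<^term>\<open>f n\<close> stay below a level \<open>Hi\<close>, and away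
  from \<^term>\<open>a\<close> and \<^term>\<open>- a\<close> they stay above a level \<open>Lo > Hi\<close>; by the double-well shape this
  needs convergence at four points only. Hence the mass away from the wells is smaller than the
  total mass by a factor of order \<open>exp (- \<theta> (Lo - Hi))\<close>. One unit of \<open>\<theta>\<close> is set aside to make the tail
  integrable by coercivity.
\<close>

lemma tendsto_gibbs_abs_mean_double_well:
  fixes f :: "nat \<Rightarrow> real \<Rightarrow> real"
  assumes f: "\<And>n. continuous_on UNIV (f n)" and g: "isCont g a"
    and lim: "\<And>u. (\<lambda>n. f n u) \<longlonglongrightarrow> g u"
    and fw: "\<forall>\<^sub>F n in sequentially. double_well (f n) (m n)" and gw: "double_well g a"
    and coercive: "\<forall>\<^sub>F n in sequentially. \<forall>u. u ^ 2 - B \<le> f n u"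
    and \<theta>: "filterlim \<theta> at_top sequentially"
  shows "(\<lambda>n. gibbs_abs_mean (\<theta> n) (f n)) \<longlonglongrightarrow> a"
proof (rule tendstoI)
  fix e :: real assume "0 < e"
  have a: "0 < a" using double_well_pos[OF gw] .
  define d where "d = min (e / 2) (a / 2)"
  have d: "0 < d" "d < a" "d \<le> e / 2" using \<open>0 < e\<close> a by (auto simp: d_def)
  (* Thirds of the gap between the minimum and the values at a - d and a + d: Hi lies one third
     and Lo two thirds of the way up. *)
  define h where "h = (min (g (a - d)) (g (a + d)) - g a) / 3"
  have h: "0 < h" "g a + 2 * h < g (a - d)" "g a + 2 * h < g (a + d)"
    using double_well_less(1)[OF gw, of "a - d" a] double_well_less(2)[OF gw, of a "a + d"] d
    by (auto simp: h_def min_def field_simps)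
  define Lo where "Lo = g a + 2 * h"
  define Hi where "Hi = g a + h"
  have "\<forall>\<^sub>F x in at a. g x < Hi"
    using g h by (intro order_tendstoD[of g "g a"]) (auto simp: isCont_def Hi_def)
  then obtain c where c: "0 < c" "\<And>x. x \<noteq> a \<Longrightarrow> dist x a < c \<Longrightarrow> g x < Hi"
    by (auto simp: eventually_at)
  define d' where "d' = min (c / 2) (d / 2)"
  have d': "0 < d'" "d' < d" "g (a - d') < Hi" "g (a + d') < Hi"
    using c d by (auto simp: d'_def dist_real_def intro!: c(2))
  define w where "w = (\<lambda>u::real. (\<bar>u\<bar> + a) * (exp B * exp (- (u ^ 2))))"
  have w: "integrable lborel w"
    unfolding w_def distrib_right
    by (intro Bochner_Integration.integrable_add) (simp_all add: integrable_gaussian mult.left_commute[of _ "exp B"])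
  define C where "C = (LINT u|lborel. w u)"
  have "((\<lambda>x. C * exp Lo * exp (- h * x) / (2 * d')) \<longlongrightarrow> 0) at_top"
    using h(1) d'(1) by real_asymp
  then have "(\<lambda>n. C * exp Lo * exp (- h * \<theta> n) / (2 * d')) \<longlonglongrightarrow> 0"
    by (rule filterlim_compose[OF _ \<theta>])
  then have small: "\<forall>\<^sub>F n in sequentially. C * exp Lo * exp (- h * \<theta> n) / (2 * d') < e / 2"
    using \<open>0 < e\<close> by (intro order_tendstoD) auto
  have "m \<longlonglongrightarrow> a" by (rule tendsto_double_well_min[OF lim fw gw])
  then have m: "\<forall>\<^sub>F n in sequentially. a - d < m n" "\<forall>\<^sub>F n in sequentially. m n < a + d"
    using d by (auto intro: order_tendstoD)
  have vals: "\<forall>\<^sub>F n in sequentially. Lo < f n (a - d)" "\<forall>\<^sub>F n in sequentially. Lo < f n (a + d)"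
    "\<forall>\<^sub>F n in sequentially. f n (a - d') < Hi" "\<forall>\<^sub>F n in sequentially. f n (a + d') < Hi"
    using h d' by (auto intro!: order_tendstoD[OF lim] simp: Lo_def)
  have "\<forall>\<^sub>F n in sequentially. 1 \<le> \<theta> n" using \<theta> by (simp add: filterlim_at_top)
  with fw coercive small m vals show "\<forall>\<^sub>F n in sequentially. dist (gibbs_abs_mean (\<theta> n) (f n)) a < e"
  proof eventually_elim
    case (elim n)
    note W = elim(1) and co = elim(2)[rule_format] and \<theta>1 = elim(10)
    have [measurable]: "f n \<in> borel_measurable borel"
      using f by (rule borel_measurable_continuous_onI)
    define E where "E u = exp (- \<theta> n * f n u)" for u
    have E: "integrable lborel E" "integrable lborel (\<lambda>u. \<bar>u\<bar> * E u)"
      using integrable_coercive[OF f co \<theta>1] by (simp_all add: E_def[abs_def])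
    define Z where "Z = (LINT u|lborel. E u)"
    have inside: "f n u \<le> Hi" if "u \<in> {a - d'..a + d'}" for u
      using that d d' elim double_well_le(1)[OF W, of "a - d'" u] double_well_le(2)[OF W, of u "a + d'"]
      by (cases "u \<le> m n") auto
    have outside: "Lo \<le> f n u" if "d < \<bar>\<bar>u\<bar> - a\<bar>" for u
      using that d elim double_well_le(1)[OF W, of "\<bar>u\<bar>" "a - d"] double_well_le(2)[OF W, of "a + d" "\<bar>u\<bar>"]
        double_well_abs[OF W, of u] by (cases "\<bar>u\<bar> < a") auto
    have Z: "2 * d' * exp (- \<theta> n * Hi) \<le> Z"
    proof -
      have "(LINT u|lborel. indicator {a - d'..a + d'} u * exp (- \<theta> n * Hi)) \<le> Z"
        unfolding Z_def
      proof (rule integral_mono[OF _ E(1)])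
        show "indicator {a - d'..a + d'} u * exp (- \<theta> n * Hi) \<le> E u" for u
          using inside[of u] \<theta>1 by (auto simp: E_def indicator_def)
      qed (auto intro!: integrable_mult_left integrable_real_indicator simp: emeasure_lborel_Icc_eq)
      then show ?thesis using d' by simp
    qed
    then have Zpos: "0 < Z" using d' by (smt (verit) exp_gt_zero mult_pos_pos)
    have pw: "\<bar>\<bar>u\<bar> - a\<bar> * E u \<le> d * E u + exp (- (\<theta> n - 1) * Lo) * w u" for u
    proof (cases "d < \<bar>\<bar>u\<bar> - a\<bar>")
      case True
      have "(\<theta> n - 1) * Lo \<le> (\<theta> n - 1) * f n u" using outside[OF True] \<theta>1 by (intro mult_left_mono) auto
      then have "- \<theta> n * f n u \<le> - (\<theta> n - 1) * Lo + (B + - (u ^ 2))"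
        using co[of u] by (simp add: algebra_simps)
      then have "E u \<le> exp (- (\<theta> n - 1) * Lo) * (exp B * exp (- (u ^ 2)))"
        by (simp add: E_def flip: exp_add)
      then have "\<bar>\<bar>u\<bar> - a\<bar> * E u \<le> (\<bar>u\<bar> + a) * (exp (- (\<theta> n - 1) * Lo) * (exp B * exp (- (u ^ 2))))"
        using a by (intro mult_mono) (auto simp: E_def)
      moreover have "0 \<le> d * E u" using d by (simp add: E_def)
      ultimately show ?thesis by (simp add: w_def mult_ac)
    next
      case False
      then have "\<bar>\<bar>u\<bar> - a\<bar> * E u \<le> d * E u" by (intro mult_right_mono) (auto simp: E_def)
      moreover have "0 \<le> exp (- (\<theta> n - 1) * Lo) * w u" using a by (simp add: w_def)
      ultimately show ?thesis by linarith
    qed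
    have "\<bar>(LINT u|lborel. \<bar>u\<bar> * E u) - a * Z\<bar> = \<bar>LINT u|lborel. (\<bar>u\<bar> - a) * E u\<bar>"
      using E by (simp add: Z_def left_diff_distrib)
    also have "\<dots> \<le> (LINT u|lborel. \<bar>\<bar>u\<bar> - a\<bar> * E u)"
      using integral_abs_bound[of lborel "\<lambda>u. (\<bar>u\<bar> - a) * E u"] by (simp add: abs_mult E_def)
    also have "\<dots> \<le> (LINT u|lborel. d * E u + exp (- (\<theta> n - 1) * Lo) * w u)"
    proof (rule integral_mono)
      have "integrable lborel (\<lambda>u. \<bar>(\<bar>u\<bar> - a) * E u\<bar>)"
        using E by (intro integrable_abs) (simp add: left_diff_distrib)
      then show "integrable lborel (\<lambda>u. \<bar>\<bar>u\<bar> - a\<bar> * E u)" by (simp add: abs_mult E_def)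
    qed (use E w pw in auto)
    also have "\<dots> = d * Z + exp (- (\<theta> n - 1) * Lo) * C"
      using E w by (simp add: Z_def C_def)
    finally have "\<bar>(LINT u|lborel. \<bar>u\<bar> * E u) - a * Z\<bar> / Z \<le> (d * Z + exp (- (\<theta> n - 1) * Lo) * C) / Z"
      using Zpos by (intro divide_right_mono) auto
    also have "\<dots> = d + exp (- (\<theta> n - 1) * Lo) * C / Z" using Zpos by (simp add: add_divide_distrib)
    also have "exp (- (\<theta> n - 1) * Lo) * C / Z \<le> exp (- (\<theta> n - 1) * Lo) * C / (2 * d' * exp (- \<theta> n * Hi))"
    proof -
      have "0 \<le> C" unfolding C_def using a by (intro Bochner_Integration.integral_nonneg) (simp add: w_def)
      then show ?thesis using Z Zpos d' by (intro divide_left_mono) auto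
    qed
    also have "\<dots> = C * exp Lo * exp (- h * \<theta> n) / (2 * d')"
    proof -
      have "exp (- (\<theta> n - 1) * Lo) / exp (- \<theta> n * Hi) = exp Lo * exp (- h * \<theta> n)"
        by (simp add: Lo_def Hi_def algebra_simps flip: exp_diff exp_add)
      then show ?thesis by (simp add: field_simps)
    qed
    also have "\<dots> < e / 2" using elim by simp
    finally have "\<bar>(LINT u|lborel. \<bar>u\<bar> * E u) - a * Z\<bar> / Z < e" using d by simp
    moreover have "\<bar>(LINT u|lborel. \<bar>u\<bar> * E u) - a * Z\<bar> / Z = \<bar>gibbs_abs_mean (\<theta> n) (f n) - a\<bar>"
      using Zpos by (simp add: gibbs_abs_mean_def Z_def[symmetric] flip: E_def abs_divide) (simp add: E_def Z_def field_simps)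
    ultimately show ?case by (simp add: dist_real_def)
  qed
qed

section \<open>The Gaussian smoothing identity\<close>

text \<open>
  Completing the square turns the interaction \<open>\<beta> K S\<^sup>2 / n\<close> into a Gaussian integral over a
  field \<open>x\<close>, in which the spins are independent, so that their sum factorizes. Read backwards,
  \<open>exp (- n G)\<close> is, up to a constant, the density of \<open>S / n\<close> plus an independent centred Gaussian of
  variance \<open>1 / (2 \<beta> K n)\<close>.
\<close>

lemma hubbard_stratonovich:
  assumes n: "0 < n" and b: "0 < \<beta>" "0 < K"
  defines "\<sigma> \<equiv> 1 / sqrt (2 * \<beta> * K * real n)"
  shows "(1 + 2 * exp (- \<beta>)) ^ n * exp (- real n * free_energy \<beta> K x) =
    sqrt (2 * pi * \<sigma>\<^sup>2) * (\<Sum>\<omega>\<in>configs n. exp (- \<beta> * hamiltonian n K \<omega>) * normal_density (spin_sum n \<omega> / real n) \<sigma> x)"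
proof -
  define t where "t = 2 * \<beta> * K * x"
  have \<sigma>: "0 < \<sigma>" "\<sigma>\<^sup>2 = 1 / (2 * \<beta> * K * real n)" using n b by (simp_all add: \<sigma>_def power_divide)
  have pos: "0 < 1 + exp (- \<beta>) * (exp t + exp (- t))" "0 < 1 + 2 * exp (- \<beta>)"
    by (intro add_pos_pos mult_pos_pos; simp)+
  have "(\<Sum>y\<in>spins. exp (- \<beta> * y\<^sup>2 + t * y)) = 1 + exp (- \<beta>) * (exp t + exp (- t))"
    by (simp add: spins_def exp_diff exp_minus field_simps)
  then have "(1 + exp (- \<beta>) * (exp t + exp (- t))) ^ n = (\<Prod>j\<in>{1..n}. \<Sum>y\<in>spins. exp (- \<beta> * y\<^sup>2 + t * y))"
    by simp
  also have "\<dots> = (\<Sum>\<omega>\<in>configs n. \<Prod>j\<in>{1..n}. exp (- \<beta> * (\<omega> j)\<^sup>2 + t * \<omega> j))"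
    unfolding configs_def by (rule prod_sum_PiE) (auto simp: spins_def)
  also have "\<dots> = (\<Sum>\<omega>\<in>configs n. exp (- \<beta> * (\<Sum>j=1..n. (\<omega> j)\<^sup>2) + t * spin_sum n \<omega>))"
  proof (rule sum.cong)
    fix \<omega>
    have "(\<Sum>j=1..n. - \<beta> * (\<omega> j)\<^sup>2 + t * \<omega> j) = - \<beta> * (\<Sum>j=1..n. (\<omega> j)\<^sup>2) + t * spin_sum n \<omega>"
      by (simp only: sum.distrib sum_distrib_left spin_sum_def)
    then show "(\<Prod>j\<in>{1..n}. exp (- \<beta> * (\<omega> j)\<^sup>2 + t * \<omega> j)) = exp (- \<beta> * (\<Sum>j=1..n. (\<omega> j)\<^sup>2) + t * spin_sum n \<omega>)"
      by (simp only: exp_sum[symmetric] finite_atLeastAtMost)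
  qed simp
  finally have sum: "(1 + exp (- \<beta>) * (exp t + exp (- t))) ^ n = \<dots>" .
  have "exp (- real n * free_energy \<beta> K x) =
      exp (- real n * (\<beta> * K * x\<^sup>2)) * exp (c_fun \<beta> t) ^ n"
    by (simp add: free_energy_def t_def exp_of_nat_mult[symmetric] algebra_simps flip: exp_add)
  also have "exp (c_fun \<beta> t) = (1 + exp (- \<beta>) * (exp t + exp (- t))) / (1 + 2 * exp (- \<beta>))"
    using pos by (simp add: c_fun_def)
  finally have "(1 + 2 * exp (- \<beta>)) ^ n * exp (- real n * free_energy \<beta> K x) =
     exp (- real n * (\<beta> * K * x\<^sup>2)) * (1 + exp (- \<beta>) * (exp t + exp (- t))) ^ n"
    using pos(2) by (simp add: power_divide)
  also have "\<dots> = (\<Sum>\<omega>\<in>configs n. exp (- real n * (\<beta> * K * x\<^sup>2)) * exp (- \<beta> * (\<Sum>j=1..n. (\<omega> j)\<^sup>2) + t * spin_sum n \<omega>))"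
    by (simp only: sum sum_distrib_left)
  also have "\<dots> = (\<Sum>\<omega>\<in>configs n. sqrt (2 * pi * \<sigma>\<^sup>2) * (exp (- \<beta> * hamiltonian n K \<omega>) * normal_density (spin_sum n \<omega> / real n) \<sigma> x))"
  proof (rule sum.cong)
    fix \<omega> assume "\<omega> \<in> configs n"
    have "- real n * (\<beta> * K * x\<^sup>2) + (- \<beta> * (\<Sum>j=1..n. (\<omega> j)\<^sup>2) + t * spin_sum n \<omega>)
       = - \<beta> * hamiltonian n K \<omega> + - (x - spin_sum n \<omega> / real n)\<^sup>2 / (2 * \<sigma>\<^sup>2)"
      using n b unfolding hamiltonian_def spin_sum_def[symmetric] t_def \<sigma>(2)
      by (simp add: field_simps power2_eq_square)
    then have "exp (- real n * (\<beta> * K * x\<^sup>2)) * exp (- \<beta> * (\<Sum>j=1..n. (\<omega> j)\<^sup>2) + t * spin_sum n \<omega>)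
       = exp (- \<beta> * hamiltonian n K \<omega>) * exp (- (x - spin_sum n \<omega> / real n)\<^sup>2 / (2 * \<sigma>\<^sup>2))"
      by (simp only: exp_add[symmetric])
    then show "exp (- real n * (\<beta> * K * x\<^sup>2)) * exp (- \<beta> * (\<Sum>j=1..n. (\<omega> j)\<^sup>2) + t * spin_sum n \<omega>)
       = sqrt (2 * pi * \<sigma>\<^sup>2) * (exp (- \<beta> * hamiltonian n K \<omega>) * normal_density (spin_sum n \<omega> / real n) \<sigma> x)"
      using \<sigma>(1) by (simp add: normal_density_def)
  qed simp
  finally show ?thesis by (simp add: sum_distrib_left)
qed

lemma normal_abs_mean:
  fixes s \<sigma> :: real
  assumes "0 < \<sigma>"
  shows "integrable lborel (\<lambda>x. \<bar>x\<bar> * normal_density s \<sigma> x)"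
    and "\<bar>(LINT x|lborel. \<bar>x\<bar> * normal_density s \<sigma> x) - \<bar>s\<bar>\<bar> \<le> \<sigma>"
proof -
  have nn: "0 \<le> normal_density s \<sigma> x" for x using assms by simp
  have A: "has_bochner_integral lborel (\<lambda>x. normal_density s \<sigma> x * \<bar>x - s\<bar>) (\<sigma> * sqrt (2 / pi))"
    using normal_moment_abs_odd[OF assms, of s 0] by simp
  have "integrable lborel (\<lambda>x. normal_density s \<sigma> x * \<bar>x - s\<bar> + \<bar>s\<bar> * normal_density s \<sigma> x)"
    using A assms by (intro Bochner_Integration.integrable_add integrable_mult_right) (auto intro: integrable.intros)
  then show int: "integrable lborel (\<lambda>x. \<bar>x\<bar> * normal_density s \<sigma> x)"
  proof (rule Bochner_Integration.integrable_bound)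
    have "\<bar>x\<bar> * normal_density s \<sigma> x \<le> (\<bar>x - s\<bar> + \<bar>s\<bar>) * normal_density s \<sigma> x" for x
      using nn by (intro mult_right_mono) auto
    then show "AE x in lborel. norm (\<bar>x\<bar> * normal_density s \<sigma> x) \<le> norm (normal_density s \<sigma> x * \<bar>x - s\<bar> + \<bar>s\<bar> * normal_density s \<sigma> x)"
      using nn by (simp add: algebra_simps)
  qed simp
  have "\<bar>(LINT x|lborel. \<bar>x\<bar> * normal_density s \<sigma> x) - \<bar>s\<bar>\<bar> = \<bar>LINT x|lborel. (\<bar>x\<bar> - \<bar>s\<bar>) * normal_density s \<sigma> x\<bar>"
    using int assms by (simp add: left_diff_distrib)
  also have "\<dots> \<le> (LINT x|lborel. \<bar>\<bar>x\<bar> - \<bar>s\<bar>\<bar> * normal_density s \<sigma> x)"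
    using integral_abs_bound[of lborel "\<lambda>x. (\<bar>x\<bar> - \<bar>s\<bar>) * normal_density s \<sigma> x"] nn by (simp add: abs_mult)
  also have "\<dots> \<le> (LINT x|lborel. normal_density s \<sigma> x * \<bar>x - s\<bar>)"
  proof (rule integral_mono)
    have "integrable lborel (\<lambda>x. \<bar>(\<bar>x\<bar> - \<bar>s\<bar>) * normal_density s \<sigma> x\<bar>)"
      using int assms by (intro integrable_abs) (simp add: left_diff_distrib)
    then show "integrable lborel (\<lambda>x. \<bar>\<bar>x\<bar> - \<bar>s\<bar>\<bar> * normal_density s \<sigma> x)"
      using nn by (simp add: abs_mult)
    show "integrable lborel (\<lambda>x. normal_density s \<sigma> x * \<bar>x - s\<bar>)" using A by (rule integrable.intros)
    show "\<bar>\<bar>x\<bar> - \<bar>s\<bar>\<bar> * normal_density s \<sigma> x \<le> normal_density s \<sigma> x * \<bar>x - s\<bar>" for x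
      using mult_right_mono[OF abs_triangle_ineq3[of x s] nn[of x]] by (simp add: mult.commute)
  qed
  also have "\<dots> = \<sigma> * sqrt (2 / pi)" using A by (rule has_bochner_integral_integral_eq)
  also have "\<dots> \<le> \<sigma> * 1" using assms pi_gt3 by (intro mult_left_mono) auto
  finally show "\<bar>(LINT x|lborel. \<bar>x\<bar> * normal_density s \<sigma> x) - \<bar>s\<bar>\<bar> \<le> \<sigma>" by simp
qed

text \<open>
  Adding a centred Gaussian of standard deviation \<open>\<sigma>\<close> changes a mean absolute value by at
  most \<open>\<sigma>\<close>. This is negligible because \<open>S / n\<close> turns out to be at least of order
  \<open>n powr (- 1 / 6)\<close>.
\<close>

lemma expect_abs_near_gibbs_abs_mean:
  assumes n: "0 < n" and b: "0 < \<beta>" "0 < K"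
  shows "\<bar>expect n \<beta> K (\<lambda>\<omega>. \<bar>spin_sum n \<omega> / real n\<bar>) - gibbs_abs_mean (real n) (free_energy \<beta> K)\<bar>
           \<le> 1 / sqrt (2 * \<beta> * K * real n)"
proof -
  define \<sigma> where "\<sigma> = 1 / sqrt (2 * \<beta> * K * real n)"
  define s where "s \<omega> = spin_sum n \<omega> / real n" for \<omega>
  define p where "p \<omega> = exp (- \<beta> * hamiltonian n K \<omega>) / partition_fun n \<beta> K" for \<omega>
  define Z where "Z = partition_fun n \<beta> K"
  define A where "A \<omega> = (LINT x|lborel. \<bar>x\<bar> * normal_density (s \<omega>) \<sigma> x)" for \<omega>
  define c where "c = sqrt (2 * pi * \<sigma>\<^sup>2) * Z / (1 + 2 * exp (- \<beta>)) ^ n"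
  have \<sigma>: "0 < \<sigma>" using n b by (simp add: \<sigma>_def)
  have Z: "0 < Z" by (simp add: Z_def partition_fun_pos)
  have "0 < 1 + 2 * exp (- \<beta>)" by (simp add: add_pos_pos)
  then have c: "0 < c" using \<sigma> Z by (simp add: c_def)
  have dens: "exp (- real n * free_energy \<beta> K x) = c * (\<Sum>\<omega>\<in>configs n. p \<omega> * normal_density (s \<omega>) \<sigma> x)" for x
  proof -
    have "(1 + 2 * exp (- \<beta>)) ^ n * exp (- real n * free_energy \<beta> K x) =
        sqrt (2 * pi * \<sigma>\<^sup>2) * (\<Sum>\<omega>\<in>configs n. Z * (p \<omega> * normal_density (s \<omega>) \<sigma> x))"
      using hubbard_stratonovich[OF n b, of x] Z unfolding p_def s_def \<sigma>_def Z_def by simp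
    also have "\<dots> = sqrt (2 * pi * \<sigma>\<^sup>2) * Z * (\<Sum>\<omega>\<in>configs n. p \<omega> * normal_density (s \<omega>) \<sigma> x)"
      by (simp add: sum_distrib_left mult.assoc)
    finally show ?thesis using \<open>0 < 1 + 2 * exp (- \<beta>)\<close> unfolding c_def
      by (simp add: eq_divide_eq mult.commute)
  qed
  have psum: "(\<Sum>\<omega>\<in>configs n. p \<omega>) = 1"
    using Z by (simp add: p_def Z_def partition_fun_def sum_divide_distrib[symmetric])
  have p: "0 \<le> p \<omega>" for \<omega> using Z by (simp add: p_def Z_def)
  have "(LINT x|lborel. exp (- real n * free_energy \<beta> K x)) = c * (\<Sum>\<omega>\<in>configs n. p \<omega> * 1)"
    unfolding dens using \<sigma> by (simp add: Bochner_Integration.integral_sum)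
  then have I0: "(LINT x|lborel. exp (- real n * free_energy \<beta> K x)) = c" by (simp add: psum)
  have "(LINT x|lborel. \<bar>x\<bar> * exp (- real n * free_energy \<beta> K x))
      = (LINT x|lborel. c * (\<Sum>\<omega>\<in>configs n. p \<omega> * (\<bar>x\<bar> * normal_density (s \<omega>) \<sigma> x)))"
    unfolding dens by (simp add: sum_distrib_left mult_ac)
  also have "\<dots> = c * (\<Sum>\<omega>\<in>configs n. p \<omega> * A \<omega>)"
    unfolding A_def using normal_abs_mean(1)[OF \<sigma>] by (simp add: Bochner_Integration.integral_sum)
  finally have I1: "(LINT x|lborel. \<bar>x\<bar> * exp (- real n * free_energy \<beta> K x)) = c * (\<Sum>\<omega>\<in>configs n. p \<omega> * A \<omega>)" .
  have mean: "gibbs_abs_mean (real n) (free_energy \<beta> K) = (\<Sum>\<omega>\<in>configs n. p \<omega> * A \<omega>)"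
    unfolding gibbs_abs_mean_def I0 I1 using c by simp
  have "expect n \<beta> K (\<lambda>\<omega>. \<bar>s \<omega>\<bar>) = (\<Sum>\<omega>\<in>configs n. p \<omega> * \<bar>s \<omega>\<bar>)"
    unfolding expect_def gibbs_def using p
    by (subst lebesgue_integral_point_measure_finite) (simp_all add: finite_configs p_def)
  then have "\<bar>expect n \<beta> K (\<lambda>\<omega>. \<bar>s \<omega>\<bar>) - gibbs_abs_mean (real n) (free_energy \<beta> K)\<bar>
      = \<bar>\<Sum>\<omega>\<in>configs n. p \<omega> * (\<bar>s \<omega>\<bar> - A \<omega>)\<bar>"
    by (simp add: mean right_diff_distrib sum_subtractf)
  also have "\<dots> \<le> (\<Sum>\<omega>\<in>configs n. \<bar>p \<omega> * (\<bar>s \<omega>\<bar> - A \<omega>)\<bar>)" by (rule sum_abs)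
  also have "\<dots> \<le> (\<Sum>\<omega>\<in>configs n. p \<omega> * \<sigma>)"
    using normal_abs_mean(2)[OF \<sigma>] p
    by (intro sum_mono) (auto simp: abs_mult A_def abs_minus_commute intro!: mult_left_mono)
  also have "\<dots> = \<sigma>" by (simp add: psum flip: sum_distrib_right)
  finally show ?thesis by (simp add: \<sigma>_def s_def)
qed

section \<open>The parameter sequences\<close>

lemma \<beta>c_pos: "0 < \<beta>c" and exp_\<beta>c: "exp \<beta>c = 4"
  by (simp_all add: \<beta>c_def)

lemma Kcrit_deriv:
  assumes "0 < b"
  shows "deriv Kcrit b = exp b / (4 * b) - (exp b + 2) / (4 * b ^ 2)"
proof (rule DERIV_imp_deriv)
  show "(Kcrit has_real_derivative exp b / (4 * b) - (exp b + 2) / (4 * b ^ 2)) (at b)"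
    unfolding Kcrit_def[abs_def] using assms
    by (auto intro!: derivative_eq_intros simp: field_simps power2_eq_square)
qed

lemma Kcrit_deriv2:
  assumes "0 < b"
  shows "deriv (deriv Kcrit) b = exp b / (4 * b) - exp b / (2 * b ^ 2) + (exp b + 2) / (2 * b ^ 3)"
proof (rule DERIV_imp_deriv)
  have "((\<lambda>b. exp b / (4 * b) - (exp b + 2) / (4 * b ^ 2)) has_real_derivative
          exp b / (4 * b) - exp b / (2 * b ^ 2) + (exp b + 2) / (2 * b ^ 3)) (at b)"
    using assms
    by (auto intro!: derivative_eq_intros simp: field_simps power2_eq_square power3_eq_cube)
  then show "(deriv Kcrit has_real_derivative
          exp b / (4 * b) - exp b / (2 * b ^ 2) + (exp b + 2) / (2 * b ^ 3)) (at b)"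
    by (rule has_field_derivative_transform_within_open[of _ _ _ "{0<..}"])
       (use assms in \<open>auto simp: Kcrit_deriv\<close>)
qed

lemma Kcrit_at_\<beta>c:
  "Kcrit \<beta>c = 3 / (2 * \<beta>c)"
  "deriv Kcrit \<beta>c = 1 / \<beta>c - 3 / (2 * \<beta>c ^ 2)"
  "deriv (deriv Kcrit) \<beta>c = 1 / \<beta>c - 2 / \<beta>c ^ 2 + 3 / \<beta>c ^ 3"
  using \<beta>c_pos by (simp_all add: Kcrit_def Kcrit_deriv Kcrit_deriv2 exp_\<beta>c)

text \<open>
  Here \<^term>\<open>e\<close> is the distance \<open>\<beta>c - \<beta>\<close>, and \<^term>\<open>k e\<close> and \<open>2 exp (- e)\<close> are the values of
  \<open>2 \<beta> K\<close> and \<open>exp \<beta> / 2\<close> along the curve. The choice of \<open>K'\<close> as the slope of the curve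
  makes the first-order terms of \<open>k - a - 1\<close> cancel, and the curvature \<^term>\<open>l\<close> enters at second
  order, relative to \<open>K''\<close>.
\<close>

lemma parameter_expansion:
  fixes L l :: real
  assumes "0 < L"
  defines "k \<equiv> (\<lambda>e. 2 * (L - e) * (3 / (2 * L) - (1 / L - 3 / (2 * L ^ 2)) * e + l * e ^ 2 / 2))"
  shows "((\<lambda>e. (k e - 2 * exp (- e) - 1) / e ^ 2) \<longlongrightarrow> L * (l - (1 / L - 2 / L ^ 2 + 3 / L ^ 3))) (at_right 0)"
    and "((\<lambda>e. (3 - k e) / e) \<longlongrightarrow> 2) (at_right 0)"
    and "(k \<longlongrightarrow> 3) (at_right 0)"
proof -
  have k: "k e = 3 - 2 * e + (l * L + 2 / L - 3 / L ^ 2) * e ^ 2 - l * e ^ 3" for e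
    unfolding k_def using assms by (simp add: field_simps power2_eq_square power3_eq_cube)
  define A where "A = l * L + 2 / L - 3 / L ^ 2"
  have A: "L * (l - (1 / L - 2 / L ^ 2 + 3 / L ^ 3)) = A - 1"
    unfolding A_def using assms by (simp add: field_simps power2_eq_square power3_eq_cube)
  show "((\<lambda>e. (k e - 2 * exp (- e) - 1) / e ^ 2) \<longlongrightarrow> L * (l - (1 / L - 2 / L ^ 2 + 3 / L ^ 3))) (at_right 0)"
    unfolding A unfolding k A_def[symmetric] by real_asymp
  show "((\<lambda>e. (3 - k e) / e) \<longlongrightarrow> 2) (at_right 0)"
    unfolding k A_def[symmetric] by real_asymp
  show "(k \<longlongrightarrow> 3) (at_right 0)"
    unfolding k[abs_def] A_def[symmetric] by real_asymp
qed

lemma continuous_free_energy: "continuous_on UNIV (free_energy \<beta> K)"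
proof -
  have "0 < 1 + exp (- \<beta>) * (exp t + exp (- t))" "0 < 1 + 2 * exp (- \<beta>)" for t :: real
    by (intro add_pos_pos mult_pos_pos; simp)+
  then show ?thesis unfolding free_energy_def[abs_def] c_fun_def
    by (intro continuous_intros) (auto simp: less_imp_neq[symmetric])
qed

text \<open>
  The spatial scale is \<open>\<delta> = n powr (- \<kappa> / 2)\<close>. On the scale \<open>\<kappa> = \<alpha>\<close>, with \<open>\<rho> = 1\<close>, all three terms of
  the sextic survive; this is the scale of the magnetization. On the coarser scale \<open>\<kappa> < \<alpha>\<close>, with \<open>\<rho> = 0\<close>,
  only the sixth power does.
\<close>

lemma scaled_free_energy:
  fixes l \<alpha> \<kappa> \<rho> :: real
  assumes l: "l > deriv (deriv Kcrit) \<beta>c" and \<alpha>: "0 < \<alpha>" and \<kappa>: "0 < \<kappa>"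
    and \<rho>: "(\<lambda>n. real n powr (\<kappa> - \<alpha>)) \<longlonglongrightarrow> \<rho>"
  defines "\<delta> \<equiv> (\<lambda>n. 1 / real n powr (\<kappa> / 2))"
    and "G \<equiv> (\<lambda>n. free_energy (\<beta>seq \<alpha> n) (Kseq l \<alpha> n))"
    and "g \<equiv> sextic (\<beta>c * (l - deriv (deriv Kcrit) \<beta>c) * \<rho> ^ 2) (2 * \<rho>)"
  shows "(\<lambda>n. G n (\<delta> n * u) / \<delta> n ^ 6) \<longlonglongrightarrow> g u"
    and "\<forall>\<^sub>F n in sequentially. \<exists>m. double_well (G n) m"
    and "\<exists>B. (\<forall>\<^sub>F n in sequentially. \<forall>u. u ^ 2 - B \<le> G n (\<delta> n * u) / \<delta> n ^ 6) \<and> (\<forall>u. u ^ 2 - B \<le> g u)"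
    and "(\<lambda>n. 2 * \<beta>seq \<alpha> n * Kseq l \<alpha> n) \<longlonglongrightarrow> 3"
    and "\<forall>\<^sub>F n in sequentially. 0 < \<beta>seq \<alpha> n \<and> 0 < Kseq l \<alpha> n"
proof -
  define e where "e n = 1 / real n powr \<alpha>" for n
  define q where "q = \<beta>c * (l - deriv (deriv Kcrit) \<beta>c)"
  define a where "a n = exp (\<beta>seq \<alpha> n) / 2" for n
  define k where "k n = 2 * \<beta>seq \<alpha> n * Kseq l \<alpha> n" for n
  have q: "0 < q" using l \<beta>c_pos by (simp add: q_def)
  have "\<forall>\<^sub>F n in sequentially. 0 < e n"
    using eventually_gt_at_top[of 0] by eventually_elim (simp add: e_def)
  moreover have e0: "e \<longlonglongrightarrow> 0" unfolding e_def using \<alpha> by real_asymp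
  ultimately have e: "filterlim e (at_right 0) sequentially"
    by (auto simp: filterlim_at elim: eventually_mono)
  have \<delta>_pos: "\<forall>\<^sub>F n in sequentially. 0 < \<delta> n"
    using eventually_gt_at_top[of 0] by eventually_elim (simp add: \<delta>_def)
  have \<delta>0: "\<delta> \<longlonglongrightarrow> 0" unfolding \<delta>_def using \<kappa> by real_asymp
  have \<beta>_e: "\<beta>seq \<alpha> n = \<beta>c - e n" for n by (simp add: \<beta>seq_def e_def)
  have e2: "e n ^ 2 = 1 / real n powr (2 * \<alpha>)" for n
  proof -
    have "2 * \<alpha> = \<alpha> + \<alpha>" by simp
    then show ?thesis unfolding e_def power2_eq_square by (simp only: powr_add) simp
  qed
  have K_e: "Kseq l \<alpha> n = 3 / (2 * \<beta>c) - (1 / \<beta>c - 3 / (2 * \<beta>c ^ 2)) * e n + l * e n ^ 2 / 2" for n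
    unfolding Kseq_def Kcrit_at_\<beta>c e2 by (simp add: e_def)
  have a_e: "a n = 2 * exp (- e n)" for n
    by (simp add: a_def \<beta>_e exp_diff exp_\<beta>c exp_minus field_simps)
  have k_lim: "k \<longlonglongrightarrow> 3"
    unfolding k_def \<beta>_e K_e by (rule filterlim_compose[OF parameter_expansion(3)[OF \<beta>c_pos] e])
  have ka: "(\<lambda>n. (k n - a n - 1) / e n ^ 2) \<longlonglongrightarrow> q"
    unfolding k_def \<beta>_e K_e a_e q_def Kcrit_at_\<beta>c
    by (rule filterlim_compose[OF parameter_expansion(1)[OF \<beta>c_pos] e])
  have k3: "(\<lambda>n. (3 - k n) / e n) \<longlonglongrightarrow> 2"
    unfolding k_def \<beta>_e K_e by (rule filterlim_compose[OF parameter_expansion(2)[OF \<beta>c_pos] e])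
  have "a \<longlonglongrightarrow> 2 * exp (- 0)" unfolding a_e by (intro tendsto_intros e0)
  then have a_lim: "a \<longlonglongrightarrow> 2" by simp
  have "(\<lambda>n. \<beta>seq \<alpha> n) \<longlonglongrightarrow> \<beta>c - 0" unfolding \<beta>_e by (intro tendsto_intros e0)
  then have "\<forall>\<^sub>F n in sequentially. 0 < \<beta>seq \<alpha> n" using \<beta>c_pos by (intro order_tendstoD) auto
  moreover have "\<forall>\<^sub>F n in sequentially. 2 < k n" using k_lim by (rule order_tendstoD) simp
  ultimately show pos: "\<forall>\<^sub>F n in sequentially. 0 < \<beta>seq \<alpha> n \<and> 0 < Kseq l \<alpha> n"
  proof eventually_elim
    case (elim n)
    then have "0 < \<beta>seq \<alpha> n * Kseq l \<alpha> n" by (simp add: k_def)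
    then show ?case using elim(1) zero_less_mult_pos by blast
  qed
  have "\<forall>\<^sub>F n in sequentially. 0 < (k n - a n - 1) / e n ^ 2" using ka q by (rule order_tendstoD)
  moreover have "\<forall>\<^sub>F n in sequentially. 0 < (3 - k n) / e n" using k3 by (rule order_tendstoD) simp
  ultimately have ak: "\<forall>\<^sub>F n in sequentially. a n + 1 < k n \<and> k n \<le> 3 \<and> 2 \<le> k n"
    using \<open>\<forall>\<^sub>F n in sequentially. 2 < k n\<close> \<open>\<forall>\<^sub>F n in sequentially. 0 < e n\<close>
    by eventually_elim (auto simp: zero_less_divide_iff)
  have a_pos: "0 < a n" for n by (simp add: a_def)
  have a_le: "a n \<le> 2" for n by (simp add: a_e e_def)
  have G: "G n x = well (a n) (k n) (k n * x)" for n x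
    by (simp add: G_def free_energy_eq_well a_def k_def)
  have e\<delta>: "\<forall>\<^sub>F n in sequentially. real n powr (\<kappa> - \<alpha>) = e n / \<delta> n ^ 2"
    using eventually_gt_at_top[of 0]
    by eventually_elim (simp add: e_def \<delta>_def powr_diff power_divide power2_eq_square flip: powr_add)
  have ratio: "(\<lambda>n. e n / \<delta> n ^ 2) \<longlonglongrightarrow> \<rho>" using \<rho> e\<delta> by (rule Lim_transform_eventually)
  have "(\<lambda>n. (k n - a n - 1) / e n ^ 2 * (e n / \<delta> n ^ 2) ^ 2) \<longlonglongrightarrow> q * \<rho> ^ 2"
    by (intro tendsto_intros ka ratio)
  moreover have "\<forall>\<^sub>F n in sequentially. (k n - a n - 1) / e n ^ 2 * (e n / \<delta> n ^ 2) ^ 2 = (k n - a n - 1) / \<delta> n ^ 4"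
    using \<open>\<forall>\<^sub>F n in sequentially. 0 < e n\<close>
    by eventually_elim (simp add: power_divide flip: power_mult)
  ultimately have q\<delta>: "(\<lambda>n. (k n - a n - 1) / \<delta> n ^ 4) \<longlonglongrightarrow> q * \<rho> ^ 2"
    by (rule Lim_transform_eventually)
  have "(\<lambda>n. (3 - k n) / e n * (e n / \<delta> n ^ 2)) \<longlonglongrightarrow> 2 * \<rho>"
    by (intro tendsto_intros k3 ratio)
  moreover have "\<forall>\<^sub>F n in sequentially. (3 - k n) / e n * (e n / \<delta> n ^ 2) = (3 - k n) / \<delta> n ^ 2"
    using \<open>\<forall>\<^sub>F n in sequentially. 0 < e n\<close> by eventually_elim simp
  ultimately have r\<delta>: "(\<lambda>n. (3 - k n) / \<delta> n ^ 2) \<longlonglongrightarrow> 2 * \<rho>"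
    by (rule Lim_transform_eventually)
  have "\<forall>\<^sub>F n in sequentially. 0 < \<delta> n \<and> a n + 1 \<le> k n \<and> k n \<le> 3"
    using \<delta>_pos ak by eventually_elim auto
  from well_scaling_limit[OF a_lim k_lim \<delta>0 this q\<delta> r\<delta>]
  have lim: "(\<lambda>n. G n (\<delta> n * u) / \<delta> n ^ 6) \<longlonglongrightarrow> g u" for u
    by (simp add: G g_def q_def)
  show "(\<lambda>n. G n (\<delta> n * u) / \<delta> n ^ 6) \<longlonglongrightarrow> g u" by (rule lim)
  show "\<forall>\<^sub>F n in sequentially. \<exists>m. double_well (G n) m"
    using ak
  proof eventually_elim
    case (elim n)
    then obtain m where "double_well (well (a n) (k n)) m"
      using double_well_well[OF a_pos[of n], of "k n"] by blast
    then have "double_well (\<lambda>x. well (a n) (k n) (k n * x) / 1) (m / k n)"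
      using elim by (intro double_well_rescale) auto
    then show ?case by (auto simp: G[abs_def])
  qed
  have "0 \<le> q * \<rho> ^ 2 + 1" using q by simp
  then obtain B where B: "\<And>a k \<delta> u. 0 < a \<Longrightarrow> a \<le> 2 \<Longrightarrow> 2 \<le> k \<Longrightarrow> a + 1 \<le> k \<Longrightarrow> k \<le> 3 \<Longrightarrow> 0 < \<delta> \<Longrightarrow> 6 * \<delta> ^ 4 \<le> 1 \<Longrightarrow>
     k - a - 1 \<le> (q * \<rho> ^ 2 + 1) * \<delta> ^ 4 \<Longrightarrow> u ^ 2 - B \<le> well a k (k * (\<delta> * u)) / \<delta> ^ 6"
    using well_coercive by blast
  have "(\<lambda>n. 6 * \<delta> n ^ 4) \<longlonglongrightarrow> 6 * 0 ^ 4" by (intro tendsto_intros \<delta>0)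
  then have "\<forall>\<^sub>F n in sequentially. 6 * \<delta> n ^ 4 < 1" by (rule order_tendstoD) simp
  moreover have "\<forall>\<^sub>F n in sequentially. (k n - a n - 1) / \<delta> n ^ 4 < q * \<rho> ^ 2 + 1"
    using q\<delta> by (rule order_tendstoD) simp
  ultimately have B': "\<forall>\<^sub>F n in sequentially. \<forall>u. u ^ 2 - B \<le> G n (\<delta> n * u) / \<delta> n ^ 6"
    using \<delta>_pos ak
  proof eventually_elim
    case (elim n)
    then have "k n - a n - 1 \<le> (q * \<rho> ^ 2 + 1) * \<delta> n ^ 4" by (simp add: pos_divide_less_eq)
    then show ?case unfolding G using elim by (intro allI B a_pos a_le) auto
  qed
  moreover have "u ^ 2 - B \<le> g u" for u
    by (rule tendsto_lowerbound[OF lim[of u]]) (use B' in \<open>auto elim: eventually_mono\<close>)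
  ultimately show "\<exists>B. (\<forall>\<^sub>F n in sequentially. \<forall>u. u ^ 2 - B \<le> G n (\<delta> n * u) / \<delta> n ^ 6) \<and> (\<forall>u. u ^ 2 - B \<le> g u)"
    by blast
  show "(\<lambda>n. 2 * \<beta>seq \<alpha> n * Kseq l \<alpha> n) \<longlonglongrightarrow> 3" using k_lim by (simp add: k_def[abs_def])
qed

lemma magnetization_double_well:
  assumes "double_well (free_energy \<beta> K) m"
  shows "magnetization \<beta> K = m"
    and "\<exists>!x. 0 < x \<and> x \<in> minimizers \<beta> K"
    and "0 < \<beta> \<Longrightarrow> 0 < K \<Longrightarrow> (\<beta>, K) \<in> phase_coexistence"
proof -
  have "m \<noteq> - m" using double_well_pos[OF assms] by simp
  then show "0 < \<beta> \<Longrightarrow> 0 < K \<Longrightarrow> (\<beta>, K) \<in> phase_coexistence"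
    by (auto simp: phase_coexistence_def minimizers_def global_min_points_double_well[OF assms])
qed (simp_all add: magnetization_def minimizers_def positive_global_min_double_well[OF assms])

lemma double_well_g_lim:
  assumes "l > deriv (deriv Kcrit) \<beta>c"
  shows "double_well (g_lim l) (x_bar l)" and "\<exists>!x. 0 < x \<and> x \<in> global_min_points (g_lim l)"
    and "g_lim l = sextic (\<beta>c * (l - deriv (deriv Kcrit) \<beta>c)) 2"
proof -
  show eq: "g_lim l = sextic (\<beta>c * (l - deriv (deriv Kcrit) \<beta>c)) 2"
    by (simp add: fun_eq_iff g_lim_def sextic_def c4_def c6_def field_simps)
  obtain m where m: "double_well (g_lim l) m"
    unfolding eq using double_well_sextic assms \<beta>c_pos by fastforce
  then have "x_bar l = m" by (simp add: x_bar_def positive_global_min_double_well)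
  with m show "double_well (g_lim l) (x_bar l)" by simp
  show "\<exists>!x. 0 < x \<and> x \<in> global_min_points (g_lim l)"
    by (simp add: positive_global_min_double_well[OF m])
qed

text \<open>
  Rescaled minimum points are minimum points of the rescaled free energy, which converges to
  \<^term>\<open>g_lim l\<close>.
\<close>

lemma magnetization_scaling:
  assumes l: "l > deriv (deriv Kcrit) \<beta>c" and \<alpha>: "0 < \<alpha>"
  shows "(\<lambda>n. magnetization (\<beta>seq \<alpha> n) (Kseq l \<alpha> n) / (1 / real n powr (\<alpha> / 2))) \<longlonglongrightarrow> x_bar l"
proof -
  have one: "(\<lambda>n. real n powr (\<alpha> - \<alpha>)) \<longlonglongrightarrow> 1" by real_asymp
  note S = scaled_free_energy[OF l \<alpha> \<alpha> one, simplified, folded double_well_g_lim(3)[OF l], simplified]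
  show ?thesis
  proof (rule tendsto_double_well_min[OF _ _ double_well_g_lim(1)[OF l]])
    show "(\<lambda>n. free_energy (\<beta>seq \<alpha> n) (Kseq l \<alpha> n) (1 / real n powr (\<alpha> / 2) * u) / (1 / real n powr (\<alpha> / 2)) ^ 6) \<longlonglongrightarrow> g_lim l u" for u
      using S(1)[of u] by simp
    show "\<forall>\<^sub>F n in sequentially. double_well
       (\<lambda>u. free_energy (\<beta>seq \<alpha> n) (Kseq l \<alpha> n) (1 / real n powr (\<alpha> / 2) * u) / (1 / real n powr (\<alpha> / 2)) ^ 6)
       (magnetization (\<beta>seq \<alpha> n) (Kseq l \<alpha> n) / (1 / real n powr (\<alpha> / 2)))"
      using S(2) eventually_gt_at_top[of 0]
    proof eventually_elim
      case (elim n)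
      then obtain m where "double_well (free_energy (\<beta>seq \<alpha> n) (Kseq l \<alpha> n)) m" by blast
      then show ?case using elim magnetization_double_well(1) by (intro double_well_rescale) auto
    qed
  qed
qed

text \<open>
  On the scale \<open>\<delta>\<close> the exponent \<open>n G\<close> is \<open>n \<delta>\<^sup>6 = n powr (1 - 3 \<kappa>)\<close> times the rescaled free
  energy, and the Gaussian smoothing error \<open>n powr (- 1 / 2)\<close> is of lower order since \<^term>\<open>\<kappa> < 1\<close>.
\<close>

lemma expect_abs_scaling:
  assumes l: "l > deriv (deriv Kcrit) \<beta>c" and \<alpha>: "0 < \<alpha>" and \<kappa>: "0 < \<kappa>" "\<kappa> < 1"
    and \<rho>: "(\<lambda>n. real n powr (\<kappa> - \<alpha>)) \<longlonglongrightarrow> \<rho>"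
  defines "\<delta> \<equiv> (\<lambda>n. 1 / real n powr (\<kappa> / 2))"
  assumes lim: "(\<lambda>n. gibbs_abs_mean (real n powr (1 - 3 * \<kappa>))
      (\<lambda>u. free_energy (\<beta>seq \<alpha> n) (Kseq l \<alpha> n) (\<delta> n * u) / \<delta> n ^ 6)) \<longlonglongrightarrow> v"
  shows "(\<lambda>n. expect n (\<beta>seq \<alpha> n) (Kseq l \<alpha> n) (\<lambda>\<omega>. \<bar>spin_sum n \<omega> / real n\<bar>) / \<delta> n) \<longlonglongrightarrow> v"
proof -
  define k where "k n = 2 * \<beta>seq \<alpha> n * Kseq l \<alpha> n" for n
  define E where "E n = expect n (\<beta>seq \<alpha> n) (Kseq l \<alpha> n) (\<lambda>\<omega>. \<bar>spin_sum n \<omega> / real n\<bar>)" for n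
  define M where "M n = gibbs_abs_mean (real n powr (1 - 3 * \<kappa>))
      (\<lambda>u. free_energy (\<beta>seq \<alpha> n) (Kseq l \<alpha> n) (\<delta> n * u) / \<delta> n ^ 6)" for n
  note S = scaled_free_energy[OF l \<alpha> \<kappa>(1) \<rho>]
  have "(\<lambda>n. real n powr (\<kappa> / 2 - 1 / 2)) \<longlonglongrightarrow> 0"
    using \<kappa> by (intro tendsto_neg_powr filterlim_real_sequentially) simp
  moreover have "\<forall>\<^sub>F n in sequentially. real n powr (\<kappa> / 2 - 1 / 2) = 1 / (\<delta> n * sqrt (real n))"
    using eventually_gt_at_top[of 0]
    by eventually_elim (simp add: \<delta>_def powr_diff powr_half_sqrt)
  ultimately have "(\<lambda>n. 1 / (\<delta> n * sqrt (real n))) \<longlonglongrightarrow> 0"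
    by (rule Lim_transform_eventually)
  moreover have "(\<lambda>n. 1 / sqrt (k n)) \<longlonglongrightarrow> 1 / sqrt 3"
    unfolding k_def by (intro tendsto_intros S(4)) simp
  ultimately have "(\<lambda>n. 1 / (\<delta> n * sqrt (real n)) * (1 / sqrt (k n))) \<longlonglongrightarrow> 0 * (1 / sqrt 3)"
    by (rule tendsto_mult)
  then have err: "(\<lambda>n. 1 / (\<delta> n * sqrt (real n)) * (1 / sqrt (k n))) \<longlonglongrightarrow> 0" by simp
  have "\<forall>\<^sub>F n in sequentially. norm (E n / \<delta> n - M n) \<le> 1 / (\<delta> n * sqrt (real n)) * (1 / sqrt (k n))"
    using S(5) eventually_gt_at_top[of 0]
  proof eventually_elim
    case (elim n)
    have \<delta>: "0 < \<delta> n" using elim by (simp add: \<delta>_def)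
    have "real n * \<delta> n ^ 6 = real n powr (1 - 3 * \<kappa>)"
      using elim by (simp add: \<delta>_def power_divide powr_diff powr_power)
    then have "gibbs_abs_mean (real n) (free_energy (\<beta>seq \<alpha> n) (Kseq l \<alpha> n)) = \<delta> n * M n"
      using gibbs_abs_mean_rescale[OF \<delta>, of "\<delta> n ^ 6" "real n"] \<delta> by (simp add: M_def)
    then have "\<bar>E n - \<delta> n * M n\<bar> \<le> 1 / sqrt (k n * real n)"
      using expect_abs_near_gibbs_abs_mean[of n "\<beta>seq \<alpha> n" "Kseq l \<alpha> n"] elim by (simp add: E_def k_def)
    then have "\<bar>E n - \<delta> n * M n\<bar> / \<delta> n \<le> 1 / sqrt (k n * real n) / \<delta> n"
      using \<delta> by (intro divide_right_mono) auto
    moreover have "\<bar>E n - \<delta> n * M n\<bar> / \<delta> n = \<bar>E n / \<delta> n - M n\<bar>"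
    proof -
      have "E n / \<delta> n - M n = (E n - \<delta> n * M n) / \<delta> n" using \<delta> by (simp add: field_simps)
      then show ?thesis using \<delta> by simp
    qed
    ultimately show ?case by (simp add: real_sqrt_mult mult_ac)
  qed
  then have "(\<lambda>n. E n / \<delta> n - M n) \<longlonglongrightarrow> 0" using err by (rule Lim_null_comparison)
  moreover have "M \<longlonglongrightarrow> v" using lim by (simp add: M_def[abs_def])
  ultimately have "(\<lambda>n. (E n / \<delta> n - M n) + M n) \<longlonglongrightarrow> 0 + v" by (rule tendsto_add)
  then show ?thesis by (simp add: E_def)
qed

section \<open>Asymptotics of the magnetization and of the spin sum\<close>

lemma sim_scaling:
  assumes "(\<lambda>n. a n / \<delta> n) \<longlonglongrightarrow> v" "v \<noteq> 0"
  shows "sim a (\<lambda>n. v * \<delta> n)" and "sim (\<lambda>n. v * \<delta> n) a"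
proof -
  have "(\<lambda>n. a n / \<delta> n / v) \<longlonglongrightarrow> v / v" using assms by (intro tendsto_intros)
  then show "sim a (\<lambda>n. v * \<delta> n)" using assms(2) by (simp add: sim_def mult.commute)
  have "(\<lambda>n. v / (a n / \<delta> n)) \<longlonglongrightarrow> v / v" using assms by (intro tendsto_intros)
  then show "sim (\<lambda>n. v * \<delta> n) a" using assms(2) by (simp add: sim_def)
qed

theorem theorem5p5:
  fixes l :: real
  assumes "l > deriv (deriv Kcrit) \<beta>c"
  shows
    "(\<exists>!x. 0 < x \<and> x \<in> global_min_points (g_lim l)) \<and>
     (\<forall>\<alpha>>0. \<forall>\<^sub>F n in sequentially.
        (\<beta>seq \<alpha> n, Kseq l \<alpha> n) \<in> phase_coexistence \<and>
        (\<exists>!x. 0 < x \<and> x \<in> minimizers (\<beta>seq \<alpha> n) (Kseq l \<alpha> n))) \<and>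
     \<comment> \<open>(a)\<close>
     (\<forall>\<alpha>>0.
        sim (\<lambda>n. magnetization (\<beta>seq \<alpha> n) (Kseq l \<alpha> n)) (\<lambda>n. x_bar l / real n powr (\<alpha> / 2)) \<and>
        (\<forall>n\<ge>1. x_bar l / real n powr (\<alpha> / 2) = x_bar l * (\<beta>c - \<beta>seq \<alpha> n) powr (1 / 2))) \<and>
     \<comment> \<open>(b)\<close>
     (\<forall>\<alpha>. 0 < \<alpha> \<and> \<alpha> < 1 / 3 \<longrightarrow>
        sim (\<lambda>n. expect n (\<beta>seq \<alpha> n) (Kseq l \<alpha> n) (\<lambda>\<omega>. \<bar>spin_sum n \<omega> / real n\<bar>))
            (\<lambda>n. x_bar l / real n powr (\<alpha> / 2)) \<and>
        sim (\<lambda>n. x_bar l / real n powr (\<alpha> / 2)) (\<lambda>n. magnetization (\<beta>seq \<alpha> n) (Kseq l \<alpha> n))) \<and>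
     \<comment> \<open>(c)\<close>
     (\<forall>\<alpha>>1 / 3.
        sim (\<lambda>n. expect n (\<beta>seq \<alpha> n) (Kseq l \<alpha> n) (\<lambda>\<omega>. \<bar>spin_sum n \<omega> / real n\<bar>))
            (\<lambda>n. y_bar / real n powr (1 / 6)) \<and>
        dominates (\<lambda>n. y_bar / real n powr (1 / 6)) (\<lambda>n. magnetization (\<beta>seq \<alpha> n) (Kseq l \<alpha> n))) \<and>
     \<comment> \<open>(d)\<close>
     (\<forall>\<alpha>. \<alpha> = 1 / 3 \<longrightarrow>
        sim (\<lambda>n. expect n (\<beta>seq \<alpha> n) (Kseq l \<alpha> n) (\<lambda>\<omega>. \<bar>spin_sum n \<omega> / real n\<bar>))
            (\<lambda>n. z_bar l / real n powr (1 / 6)) \<and>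
        sim (\<lambda>n. z_bar l / real n powr (1 / 6))
            (\<lambda>n. z_bar l * magnetization (\<beta>seq \<alpha> n) (Kseq l \<alpha> n) / x_bar l))"
proof -
  note l = assms
  define M where "M \<alpha> n = magnetization (\<beta>seq \<alpha> n) (Kseq l \<alpha> n)" for \<alpha> n
  define E where "E \<alpha> n = expect n (\<beta>seq \<alpha> n) (Kseq l \<alpha> n) (\<lambda>\<omega>. \<bar>spin_sum n \<omega> / real n\<bar>)" for \<alpha> n
  have x_pos: "0 < x_bar l" using double_well_pos[OF double_well_g_lim(1)[OF l]] .
  have M: "(\<lambda>n. M \<alpha> n / (1 / real n powr (\<alpha> / 2))) \<longlonglongrightarrow> x_bar l" if "0 < \<alpha>" for \<alpha>
    unfolding M_def by (rule magnetization_scaling[OF l that])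
  note sim_M = sim_scaling[OF M less_imp_neq[OF x_pos, symmetric], simplified]
  have one: "(\<lambda>n. real n powr (\<alpha> - \<alpha>)) \<longlonglongrightarrow> 1" for \<alpha> by real_asymp
  have powr_top: "filterlim (\<lambda>n. real n powr s) at_top sequentially" if "0 < s" for s
    using that by real_asymp
  note g_sextic = double_well_g_lim(3)[OF l, symmetric]
  have cont: "continuous_on UNIV (\<lambda>u. free_energy \<beta> K (d * u) / D)" for \<beta> K d D
    unfolding divide_inverse by (intro continuous_intros continuous_on_compose2[OF continuous_free_energy]) auto

  have coexistence: "\<forall>\<^sub>F n in sequentially. (\<beta>seq \<alpha> n, Kseq l \<alpha> n) \<in> phase_coexistence \<and>
      (\<exists>!x. 0 < x \<and> x \<in> minimizers (\<beta>seq \<alpha> n) (Kseq l \<alpha> n))" if "0 < \<alpha>" for \<alpha>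
    using scaled_free_energy(2,5)[OF l that that one]
    by eventually_elim (use magnetization_double_well in blast)

  have powr_eq: "x_bar l / real n powr (\<alpha> / 2) = x_bar l * (\<beta>c - \<beta>seq \<alpha> n) powr (1 / 2)"
    if "0 < \<alpha>" "1 \<le> n" for \<alpha> n
    using that by (simp add: \<beta>seq_def powr_divide powr_powr)

  (* For alpha < 1/3 the factor n^(1 - 3 alpha) diverges, and the mass concentrates at the
     minimum points of the limit. *)
  have subcritical: "sim (E \<alpha>) (\<lambda>n. x_bar l / real n powr (\<alpha> / 2))" if \<alpha>: "0 < \<alpha>" "\<alpha> < 1 / 3" for \<alpha>
  proof -
    obtain B where B: "\<forall>\<^sub>F n in sequentially. \<forall>u. u ^ 2 - B \<le>
        free_energy (\<beta>seq \<alpha> n) (Kseq l \<alpha> n) (1 / real n powr (\<alpha> / 2) * u) / (1 / real n powr (\<alpha> / 2)) ^ 6"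
      using scaled_free_energy(3)[OF l \<alpha>(1) \<alpha>(1) one] by blast
    define f where "f n u = free_energy (\<beta>seq \<alpha> n) (Kseq l \<alpha> n) (1 / real n powr (\<alpha> / 2) * u) / (1 / real n powr (\<alpha> / 2)) ^ 6" for n u
    have f_well: "\<forall>\<^sub>F n in sequentially. double_well (f n) (M \<alpha> n / (1 / real n powr (\<alpha> / 2)))"
      using scaled_free_energy(2)[OF l \<alpha>(1) \<alpha>(1) one] eventually_gt_at_top[of 0]
    proof eventually_elim
      case (elim n)
      then obtain m where m: "double_well (free_energy (\<beta>seq \<alpha> n) (Kseq l \<alpha> n)) m" by blast
      then show ?case unfolding f_def M_def magnetization_double_well(1)[OF m] using elim
        by (intro double_well_rescale) auto
    qed
    have f_cont: "continuous_on UNIV (f n)" for n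
      unfolding f_def by (rule cont)
    have "(\<lambda>n. gibbs_abs_mean (real n powr (1 - 3 * \<alpha>)) (f n)) \<longlonglongrightarrow> x_bar l"
    proof (rule tendsto_gibbs_abs_mean_double_well[OF f_cont _ _ f_well double_well_g_lim(1)[OF l] B[folded f_def]])
      show "isCont (g_lim l) (x_bar l)"
        unfolding g_lim_def[abs_def] by (intro continuous_intros)
      show "(\<lambda>n. f n u) \<longlonglongrightarrow> g_lim l u" for u
        using scaled_free_energy(1)[OF l \<alpha>(1) \<alpha>(1) one, of u] by (simp add: f_def g_sextic)
      show "filterlim (\<lambda>n. real n powr (1 - 3 * \<alpha>)) at_top sequentially"
        using \<alpha> by (intro powr_top) simp
    qed
    from expect_abs_scaling[OF l \<alpha>(1) \<alpha>(1) _ one this[unfolded f_def]] \<alpha>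
    have "(\<lambda>n. E \<alpha> n / (1 / real n powr (\<alpha> / 2))) \<longlonglongrightarrow> x_bar l"
      unfolding E_def by simp
    from sim_scaling(1)[OF this] x_pos show ?thesis by simp
  qed

  (* On the scale n^(-1/6) the exponent has no diverging factor, and the limit is a genuine
     average; rho = 1 for alpha = 1/3 and rho = 0 for alpha > 1/3. *)
  have critical: "(\<lambda>n. E \<alpha> n / (1 / real n powr (1 / 6))) \<longlonglongrightarrow>
      gibbs_abs_mean 1 (sextic (\<beta>c * (l - deriv (deriv Kcrit) \<beta>c) * \<rho> ^ 2) (2 * \<rho>))"
      "0 < gibbs_abs_mean 1 (sextic (\<beta>c * (l - deriv (deriv Kcrit) \<beta>c) * \<rho> ^ 2) (2 * \<rho>))"
    if \<alpha>: "0 < \<alpha>" and \<rho>: "(\<lambda>n. real n powr (1 / 3 - \<alpha>)) \<longlonglongrightarrow> \<rho>" for \<alpha> \<rho>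
  proof -
    define g where "g = sextic (\<beta>c * (l - deriv (deriv Kcrit) \<beta>c) * \<rho> ^ 2) (2 * \<rho>)"
    define f where "f n u = free_energy (\<beta>seq \<alpha> n) (Kseq l \<alpha> n) (1 / real n powr (1 / 3 / 2) * u) / (1 / real n powr (1 / 3 / 2)) ^ 6" for n u
    have third: "0 < (1 / 3 :: real)" by simp
    note S = scaled_free_energy[OF l \<alpha> third \<rho>, folded g_def f_def]
    obtain B where B: "\<forall>\<^sub>F n in sequentially. \<forall>u. u ^ 2 - B \<le> f n u" "\<And>u. u ^ 2 - B \<le> g u"
      using S(3) by blast
    have f_cont: "continuous_on UNIV (f n)" for n
      unfolding f_def by (rule cont)
    have g_cont: "continuous_on UNIV g"
      unfolding g_def sextic_def[abs_def] by (intro continuous_intros) auto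
    have "(\<lambda>n. gibbs_abs_mean 1 (f n)) \<longlonglongrightarrow> gibbs_abs_mean 1 g"
      by (rule tendsto_gibbs_abs_mean[OF f_cont g_cont S(1) B(1)])
    moreover have "\<forall>\<^sub>F n in sequentially. gibbs_abs_mean 1 (f n) = gibbs_abs_mean (real n powr (1 - 3 * (1 / 3))) (f n)"
      using eventually_gt_at_top[of 0] by eventually_elim simp
    ultimately have "(\<lambda>n. gibbs_abs_mean (real n powr (1 - 3 * (1 / 3))) (f n)) \<longlonglongrightarrow> gibbs_abs_mean 1 g"
      by (rule Lim_transform_eventually)
    from expect_abs_scaling[OF l \<alpha> third _ \<rho> this[unfolded f_def]]
    show "(\<lambda>n. E \<alpha> n / (1 / real n powr (1 / 6))) \<longlonglongrightarrow> gibbs_abs_mean 1 g"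
      unfolding E_def by simp
    show "0 < gibbs_abs_mean 1 g" by (rule gibbs_abs_mean_pos[OF g_cont B(2)])
  qed

  have y_bar: "y_bar = gibbs_abs_mean 1 (sextic 0 0)"
    by (simp add: y_bar_def gibbs_abs_mean_def g_tilde_def sextic_def c6_def)
  have z_bar: "z_bar l = gibbs_abs_mean 1 (g_lim l)"
    by (simp add: z_bar_def gibbs_abs_mean_def)

  have supercritical: "sim (E \<alpha>) (\<lambda>n. y_bar / real n powr (1 / 6)) \<and>
      dominates (\<lambda>n. y_bar / real n powr (1 / 6)) (M \<alpha>)" if \<alpha>: "1 / 3 < \<alpha>" for \<alpha>
  proof
    have \<rho>: "(\<lambda>n. real n powr (1 / 3 - \<alpha>)) \<longlonglongrightarrow> 0"
      using \<alpha> by (intro tendsto_neg_powr filterlim_real_sequentially) simp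
    have \<alpha>0: "0 < \<alpha>" using \<alpha> by simp
    have lim: "(\<lambda>n. E \<alpha> n / (1 / real n powr (1 / 6))) \<longlonglongrightarrow> y_bar" and y_pos: "0 < y_bar"
      using critical[OF \<alpha>0 \<rho>] by (simp_all add: y_bar)
    show "sim (E \<alpha>) (\<lambda>n. y_bar / real n powr (1 / 6))"
      using sim_scaling(1)[OF lim] y_pos by simp
    have "(\<lambda>n. y_bar / (M \<alpha> n / (1 / real n powr (\<alpha> / 2)))) \<longlonglongrightarrow> y_bar / x_bar l"
      using x_pos by (intro tendsto_intros M \<alpha>0) simp
    moreover have "filterlim (\<lambda>n. real n powr (\<alpha> / 2 - 1 / 6)) at_top sequentially"
      using \<alpha> by (intro powr_top) simp
    ultimately have top: "filterlim (\<lambda>n. y_bar / (M \<alpha> n / (1 / real n powr (\<alpha> / 2))) * real n powr (\<alpha> / 2 - 1 / 6)) at_top sequentially"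
      by (rule filterlim_tendsto_pos_mult_at_top[OF _ divide_pos_pos[OF y_pos x_pos]])
    have eq: "\<forall>\<^sub>F n in sequentially. y_bar / (M \<alpha> n / (1 / real n powr (\<alpha> / 2))) * real n powr (\<alpha> / 2 - 1 / 6)
        = y_bar / real n powr (1 / 6) / M \<alpha> n"
      using eventually_gt_at_top[of 0] by eventually_elim (simp add: powr_diff)
    show "dominates (\<lambda>n. y_bar / real n powr (1 / 6)) (M \<alpha>)"
      unfolding dominates_def by (rule iffD1[OF filterlim_cong[OF refl refl eq] top])
  qed

  have at_critical: "sim (E (1 / 3)) (\<lambda>n. z_bar l / real n powr (1 / 6)) \<and>
      sim (\<lambda>n. z_bar l / real n powr (1 / 6)) (\<lambda>n. z_bar l * M (1 / 3) n / x_bar l)"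
  proof
    have \<alpha>0: "0 < (1 / 3 :: real)" by simp
    have lim: "(\<lambda>n. E (1 / 3) n / (1 / real n powr (1 / 6))) \<longlonglongrightarrow> z_bar l" and z_pos: "0 < z_bar l"
      using critical[OF \<alpha>0, of 1] one[of "1 / 3"] by (simp_all add: z_bar g_sextic)
    show "sim (E (1 / 3)) (\<lambda>n. z_bar l / real n powr (1 / 6))"
      using sim_scaling(1)[OF lim] z_pos by simp
    have "(\<lambda>n. z_bar l * M (1 / 3) n / x_bar l / (1 / real n powr (1 / 6))) \<longlonglongrightarrow> z_bar l / x_bar l * x_bar l"
      using tendsto_mult[OF tendsto_const[of "z_bar l / x_bar l"] M[OF \<alpha>0]] by (simp add: mult_ac)
    then have "(\<lambda>n. z_bar l * M (1 / 3) n / x_bar l / (1 / real n powr (1 / 6))) \<longlonglongrightarrow> z_bar l" using x_pos by simp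
    from sim_scaling(2)[OF this] z_pos
    show "sim (\<lambda>n. z_bar l / real n powr (1 / 6)) (\<lambda>n. z_bar l * M (1 / 3) n / x_bar l)" by simp
  qed

  show ?thesis
    using double_well_g_lim(2)[OF l] coexistence powr_eq sim_M subcritical supercritical at_critical
    unfolding E_def[abs_def] M_def[abs_def] by blast
qed

end
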